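(* Let $X$ be a complete simplicial toric variety of dimension $n$ over an algebraically closed field $\mathbb K$ with torsion-free class group and homogeneous coordinate ring $S$. Let $Y$ be a zero-dimensional complete intersection subscheme of $X$ such that $I(Y)$ is generated by $n$ homogeneous polynomials with degrees $\alpha_1,\dots,\alpha_n$. Then for any $\alpha\in\mathcal A$ we have $$H_Y(\alpha)=\sum_{s=0}^{n}(-1)^s\sum_{I\subseteq\{1,\dots,n\},\,|I|=s}|P_{\alpha-\alpha_I}\cap M|,$$ where $\alpha_I=\sum_{i\in I}\alpha_i$.
   Context: Let $\Sigma\subset N_{\mathbb R}$ be the fan of $X$, $N$ a lattice of rank $n$ with dual lattice $M$, $v_1,\dots,v_r\in N$ the primitive generators of the rays $\rho_1,\dots,\rho_r$ of $\Sigma$, and $D_1,\dots,D_r$ the corresponding torus-invariant prime Weil divisors. Put $\mathcal A=\mathrm{Cl}(X)$. The homogeneous coordinate ring is $S=\mathbb K[x_1,\dots,x_r]=\bigoplus_{\alpha\in\mathcal A}S_\alpha$, graded by $\deg(x_j)=[D_j]\in\mathcal A$; "homogeneous" refers to this grading. The irrelevant ideal is $B=\langle\prod_{\rho_i\not\subset\sigma}x_i:\sigma\in\Sigma\rangle$, and $J:B^\infty=\{F\in S:F\cdot B^k\subseteq J\text{ for some }k\ge0\}$. For a closed subscheme $Y\subset X$, $I(Y)\subset S$ is the homogeneous ideal associated with $Y$: for reduced $Y$ it is the unique radical $B$-saturated homogeneous ideal defining $Y$; for a general closed $Y$ it is the unique homogeneous ideal defining $Y$ that is Pic-generated (generated by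 homogeneous polynomials with degrees in $\mathrm{Pic}(X)$) and Pic-saturated ($J_\alpha=(J:B^\infty)_\alpha$ for all $\alpha\in\mathrm{Pic}(X)$). $Y$ is a complete intersection if $I(Y)$ is generated by a regular sequence of homogeneous polynomials $F_1,\dots,F_k$, $k$ being the codimension of $Y$ in $X$. The multigraded Hilbert function is $H_Y(\alpha)=\dim_{\mathbb K}(S/I(Y))_\alpha$. For $D=\sum_ja_jD_j$ put $P_D=\{m\in M_{\mathbb R}:\langle m,v_j\rangle\ge-a_j,\ 1\le j\le r\}$; up to lattice translation it depends only on $\alpha=[D]$, and $P_\alpha$ denotes any such $P_D$. *)

theory Defs
  imports
    "HOL-Analysis.Analysis"
    "HOL-Computational_Algebra.Polynomial"
    "HOL-Algebra.Embedded_Algebras"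
    "HOL-Algebra.Ideal_Product"
    "HOL-Algebra.QuotRing"
    "HOL-Algebra.Free_Abelian_Groups"
begin

section \<open>Lattices, fans and class groups\<close>

text \<open>
  \<open>N\<^sub>\<real>\<close> is a real vector space with an inner product, which is used only to
  identify the dual space \<open>M\<^sub>\<real>\<close> with \<open>N\<^sub>\<real>\<close>, so that the pairing
  of \<open>m\<close> and \<open>u\<close> is \<open>m \<bullet> u\<close>. The class \<open>real_inner\<close> (instead of
  \<open>euclidean_space\<close>) does not exclude the case \<open>n = 0\<close>; finite dimension comes
  from the lattice.
\<close>

definition is_lattice :: "'a::real_inner set \<Rightarrow> nat \<Rightarrow> bool" where
  "is_lattice N n \<longleftrightarrow>
     (\<exists>B. finite B \<and> card B = n \<and> independent B \<and> span B = UNIV \<and>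
          N = {\<Sum>b\<in>B. of_int (c b) *\<^sub>R b | c. True})"

definition dual_lattice :: "'a::real_inner set \<Rightarrow> 'a set" where
  "dual_lattice N = {m. \<forall>u\<in>N. m \<bullet> u \<in> \<int>}"

definition lattice_cone :: "'a::real_inner set \<Rightarrow> 'a set \<Rightarrow> bool" where
  "lattice_cone N \<sigma> \<longleftrightarrow>
     (\<exists>G. finite G \<and> G \<subseteq> N \<and> \<sigma> = convex_cone hull G) \<and> \<sigma> \<inter> uminus ` \<sigma> = {0}"

text \<open>The relation \<open>face_of\<close> also admits the empty set, which is not a face of a cone.\<close>

definition is_fan :: "'a::real_inner set \<Rightarrow> 'a set set \<Rightarrow> bool" where
  "is_fan N \<Sigma> \<longleftrightarrow>
     finite \<Sigma> \<and> \<Sigma> \<noteq> {} \<and>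
     (\<forall>\<sigma>\<in>\<Sigma>. lattice_cone N \<sigma>) \<and>
     (\<forall>\<sigma>\<in>\<Sigma>. \<forall>\<tau>. \<tau> face_of \<sigma> \<and> \<tau> \<noteq> {} \<longrightarrow> \<tau> \<in> \<Sigma>) \<and>
     (\<forall>\<sigma>\<in>\<Sigma>. \<forall>\<tau>\<in>\<Sigma>. \<sigma> \<inter> \<tau> face_of \<sigma> \<and> \<sigma> \<inter> \<tau> face_of \<tau>)"

definition complete_fan :: "'a::real_inner set set \<Rightarrow> bool" where
  "complete_fan \<Sigma> \<longleftrightarrow> \<Union>\<Sigma> = UNIV"

definition simplicial_fan :: "'a::real_inner set set \<Rightarrow> bool" where
  "simplicial_fan \<Sigma> \<longleftrightarrow> (\<forall>\<sigma>\<in>\<Sigma>. \<exists>G. independent G \<and> \<sigma> = convex_cone hull G)"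

definition ray :: "(nat \<Rightarrow> 'a::real_inner) \<Rightarrow> nat \<Rightarrow> 'a set" where
  "ray v j = convex_cone hull {v j}"

definition primitive_ray_generators ::
    "'a::real_inner set \<Rightarrow> 'a set set \<Rightarrow> nat \<Rightarrow> (nat \<Rightarrow> 'a) \<Rightarrow> bool" where
  "primitive_ray_generators N \<Sigma> r v \<longleftrightarrow>
     bij_betw (ray v) {1..r} {\<rho>\<in>\<Sigma>. dim \<rho> = 1} \<and>
     (\<forall>j\<in>{1..r}. ray v j \<inter> N = {real k *\<^sub>R v j | k. True})"

text \<open>
  A torus-invariant Weil divisor \<open>\<Sum>\<^sub>j a\<^sub>j D\<^sub>j\<close> is the finitely
  supported function \<open>j \<mapsto> a\<^sub>j\<close>, an element of \<open>free_Abelian_group {1..r}\<close>.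
  In particular an element of \<open>Cl\<close> is a coset, i.e. a set of divisors.
\<close>

type_synonym divisor = "nat \<Rightarrow>\<^sub>0 int"

definition char_divisor :: "nat \<Rightarrow> (nat \<Rightarrow> 'a::real_inner) \<Rightarrow> 'a \<Rightarrow> divisor" where
  "char_divisor r v m = (\<Sum>j\<in>{1..r}. Poly_Mapping.single j \<lfloor>m \<bullet> v j\<rfloor>)"

definition Cl :: "'a::real_inner set \<Rightarrow> nat \<Rightarrow> (nat \<Rightarrow> 'a) \<Rightarrow> divisor set monoid" where
  "Cl N r v = free_Abelian_group {1..r} Mod (char_divisor r v ` dual_lattice N)"

definition torsion_free :: "('g, 'm) monoid_scheme \<Rightarrow> bool" where
  "torsion_free G \<longleftrightarrow>
     (\<forall>x\<in>carrier G. \<forall>k::nat. k > 0 \<and> x [^]\<^bsub>G\<^esub> k = \<one>\<^bsub>G\<^esub> \<longrightarrow> x = \<one>\<^bsub>G\<^esub>)"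

text \<open>Principal on each chart \<open>U\<^sub>\<sigma>\<close>, where \<open>D\<close> is the divisor of a character.\<close>

definition Cartier ::
    "'a::real_inner set \<Rightarrow> 'a set set \<Rightarrow> nat \<Rightarrow> (nat \<Rightarrow> 'a) \<Rightarrow> divisor \<Rightarrow> bool" where
  "Cartier N \<Sigma> r v D \<longleftrightarrow>
     (\<forall>\<sigma>\<in>\<Sigma>. \<exists>m\<in>dual_lattice N. \<forall>j\<in>{1..r}. ray v j \<subseteq> \<sigma> \<longrightarrow>
        m \<bullet> v j = - of_int (Poly_Mapping.lookup D j))"

definition Pic ::
    "'a::real_inner set \<Rightarrow> 'a set set \<Rightarrow> nat \<Rightarrow> (nat \<Rightarrow> 'a) \<Rightarrow> divisor set set" where
  "Pic N \<Sigma> r v = {\<alpha> \<in> carrier (Cl N r v). \<exists>D\<in>\<alpha>. Cartier N \<Sigma> r v D}"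

definition polytope_of :: "nat \<Rightarrow> (nat \<Rightarrow> 'a::real_inner) \<Rightarrow> divisor \<Rightarrow> 'a set" where
  "polytope_of r v D = {m. \<forall>j\<in>{1..r}. m \<bullet> v j \<ge> - of_int (Poly_Mapping.lookup D j)}"


section \<open>Rings\<close>

definition ring_on :: "'b::comm_ring_1 set \<Rightarrow> 'b ring" where
  "ring_on A = \<lparr>carrier = A, monoid.mult = (*), one = 1, ring.zero = 0, add = (+)\<rparr>"

text \<open>
  The homogeneous coordinate ring \<open>S\<close> is placed inside the ring of Laurent polynomials
  in \<open>x\<^sub>1, x\<^sub>2, \<dots>\<close> whose exponents are divisors: \<open>single D c\<close> is the
  term \<open>c x\<^sup>D\<close>. Its elements are the combinations of monomials \<open>x\<^sup>D\<close>
  with \<open>D\<close> effective, i.e. the polynomials in \<open>x\<^sub>1, \<dots>, x\<^sub>r\<close>.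
  The monomial \<open>x\<^sup>D\<close> has degree \<open>[D]\<close>.
\<close>

definition cox_ring :: "nat \<Rightarrow> (divisor \<Rightarrow>\<^sub>0 'k::field) ring" where
  "cox_ring r = ring_on {f. \<forall>D\<in>Poly_Mapping.keys f.
     Poly_Mapping.keys D \<subseteq> {1..r} \<and> (\<forall>j. Poly_Mapping.lookup D j \<ge> 0)}"

definition graded_part :: "nat \<Rightarrow> divisor set \<Rightarrow> (divisor \<Rightarrow>\<^sub>0 'k::field) set" where
  "graded_part r \<alpha> = {f \<in> carrier (cox_ring r). Poly_Mapping.keys f \<subseteq> \<alpha>}"

definition homogeneous_elements ::
    "nat \<Rightarrow> divisor set set \<Rightarrow> (divisor \<Rightarrow>\<^sub>0 'k::field) set" where
  "homogeneous_elements r \<A> = (\<Union>\<alpha>\<in>\<A>. graded_part r \<alpha>)"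

text \<open>Ideals generated by homogeneous elements with degrees in \<open>\<A>\<close>.\<close>

definition homogeneously_generated ::
    "nat \<Rightarrow> divisor set set \<Rightarrow> (divisor \<Rightarrow>\<^sub>0 'k::field) set \<Rightarrow> bool" where
  "homogeneously_generated r \<A> J \<longleftrightarrow>
     (\<exists>G \<subseteq> homogeneous_elements r \<A>. J = Idl\<^bsub>cox_ring r\<^esub> G)"

text \<open>The product of the variables \<open>x\<^sub>i\<close> such that \<open>\<rho>\<^sub>i\<close> is not contained in \<open>\<sigma>\<close>.\<close>

definition cone_monomial ::
    "nat \<Rightarrow> (nat \<Rightarrow> 'a::real_inner) \<Rightarrow> 'a set \<Rightarrow> (divisor \<Rightarrow>\<^sub>0 'k::field)" where
  "cone_monomial r v \<sigma> =
     (\<Prod>i\<in>{i\<in>{1..r}. \<not> ray v i \<subseteq> \<sigma>}. Poly_Mapping.single (Poly_Mapping.single i 1) 1)"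

definition irrelevant_ideal ::
    "'a::real_inner set set \<Rightarrow> nat \<Rightarrow> (nat \<Rightarrow> 'a) \<Rightarrow> (divisor \<Rightarrow>\<^sub>0 'k::field) set" where
  "irrelevant_ideal \<Sigma> r v = Idl\<^bsub>cox_ring r\<^esub> (cone_monomial r v ` \<Sigma>)"

definition ideal_power :: "('b, 'm) ring_scheme \<Rightarrow> 'b set \<Rightarrow> nat \<Rightarrow> 'b set" where
  "ideal_power R I k = (ideal_prod R I ^^ k) (carrier R)"

definition saturation :: "('b, 'm) ring_scheme \<Rightarrow> 'b set \<Rightarrow> 'b set \<Rightarrow> 'b set" where
  "saturation R J B =
     {f \<in> carrier R. \<exists>k. \<forall>b\<in>ideal_power R B k. f \<otimes>\<^bsub>R\<^esub> b \<in> J}"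

definition radical_ideal :: "'b set \<Rightarrow> ('b, 'm) ring_scheme \<Rightarrow> bool" where
  "radical_ideal I R \<longleftrightarrow>
     ideal I R \<and> (\<forall>f\<in>carrier R. \<forall>k::nat. f [^]\<^bsub>R\<^esub> k \<in> I \<longrightarrow> f \<in> I)"

definition regular_sequence :: "('b, 'm) ring_scheme \<Rightarrow> nat \<Rightarrow> (nat \<Rightarrow> 'b) \<Rightarrow> bool" where
  "regular_sequence R k F \<longleftrightarrow>
     F ` {1..k} \<subseteq> carrier R \<and>
     (\<forall>i\<in>{1..k}. \<forall>g\<in>carrier R.
        F i \<otimes>\<^bsub>R\<^esub> g \<in> Idl\<^bsub>R\<^esub> (F ` {1..<i}) \<longrightarrow> g \<in> Idl\<^bsub>R\<^esub> (F ` {1..<i})) \<and>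
     Idl\<^bsub>R\<^esub> (F ` {1..k}) \<noteq> carrier R"


section \<open>Closed subschemes and their ideals\<close>

text \<open>The coordinate ring of the affine chart \<open>U\<^sub>\<sigma>\<close>; \<open>single m c\<close> is \<open>c \<chi>\<^sup>m\<close>.\<close>

definition chart_ring ::
    "'a::real_inner set \<Rightarrow> 'a set \<Rightarrow> ('a \<Rightarrow>\<^sub>0 'k::field) ring" where
  "chart_ring N \<sigma> =
     ring_on {f. \<forall>m\<in>Poly_Mapping.keys f. m \<in> dual_lattice N \<and> (\<forall>u\<in>\<sigma>. m \<bullet> u \<ge> 0)}"

text \<open>
  A closed subscheme of \<open>X\<close> is a quasi-coherent sheaf of ideals. It is given by its ideals
  \<open>Y \<sigma>\<close> on the charts \<open>U\<^sub>\<sigma>\<close>, which cover \<open>X\<close> and are glued along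
  the open subsets \<open>U\<^sub>\<tau>\<close> with \<open>\<tau>\<close> a common face; restriction from
  \<open>U\<^sub>\<sigma>\<close> to \<open>U\<^sub>\<tau>\<close> is extension of ideals. Values of \<open>Y\<close>
  outside of \<open>\<Sigma>\<close> are irrelevant.
\<close>

definition closed_subscheme ::
    "'a::real_inner set \<Rightarrow> 'a set set \<Rightarrow> ('a set \<Rightarrow> ('a \<Rightarrow>\<^sub>0 'k::field) set) \<Rightarrow> bool" where
  "closed_subscheme N \<Sigma> Y \<longleftrightarrow>
     (\<forall>\<sigma>\<in>\<Sigma>. ideal (Y \<sigma>) (chart_ring N \<sigma>)) \<and>
     (\<forall>\<sigma>\<in>\<Sigma>. \<forall>\<tau>\<in>\<Sigma>. \<tau> face_of \<sigma> \<longrightarrow> Y \<tau> = Idl\<^bsub>chart_ring N \<tau>\<^esub> (Y \<sigma>))"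

definition reduced_subscheme ::
    "'a::real_inner set \<Rightarrow> 'a set set \<Rightarrow> ('a set \<Rightarrow> ('a \<Rightarrow>\<^sub>0 'k::field) set) \<Rightarrow> bool" where
  "reduced_subscheme N \<Sigma> Y \<longleftrightarrow> (\<forall>\<sigma>\<in>\<Sigma>. radical_ideal (Y \<sigma>) (chart_ring N \<sigma>))"

text \<open>
  Krull dimension of \<open>Y\<close>, as the maximum of the dimensions of its charts
  \<open>Spec (K[U\<^sub>\<sigma>] / Y \<sigma>)\<close>; the empty subscheme has no dimension.
\<close>

definition prime_chain ::
    "('b, 'm) ring_scheme \<Rightarrow> 'b set \<Rightarrow> nat \<Rightarrow> (nat \<Rightarrow> 'b set) \<Rightarrow> bool" where
  "prime_chain R I d P \<longleftrightarrow>
     (\<forall>i\<le>d. primeideal (P i) R \<and> I \<subseteq> P i) \<and> (\<forall>i<d. P i \<subset> P (Suc i))"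

definition has_dimension ::
    "'a::real_inner set \<Rightarrow> 'a set set \<Rightarrow> ('a set \<Rightarrow> ('a \<Rightarrow>\<^sub>0 'k::field) set) \<Rightarrow> nat \<Rightarrow> bool" where
  "has_dimension N \<Sigma> Y d \<longleftrightarrow>
     (\<exists>\<sigma>\<in>\<Sigma>. \<exists>P. prime_chain (chart_ring N \<sigma>) (Y \<sigma>) d P) \<and>
     (\<forall>\<sigma>\<in>\<Sigma>. \<forall>e P. prime_chain (chart_ring N \<sigma>) (Y \<sigma>) e P \<longrightarrow> e \<le> d)"

text \<open>
  The ring homomorphism \<open>\<chi>\<^sup>m \<mapsto> \<Prod>\<^sub>j x\<^sub>j\<^bsup>\<langle>m, v\<^sub>j\<rangle>\<^esup>\<close>. It restricts to Cox's
  isomorphism of the coordinate ring of \<open>U\<^sub>\<sigma>\<close> with the degree zero part of the localization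
  of \<open>S\<close> at the monomial of \<open>\<sigma>\<close>.
\<close>

definition cox_map ::
    "nat \<Rightarrow> (nat \<Rightarrow> 'a::real_inner) \<Rightarrow> ('a \<Rightarrow>\<^sub>0 'k::field) \<Rightarrow> (divisor \<Rightarrow>\<^sub>0 'k)" where
  "cox_map r v f =
     (\<Sum>m\<in>Poly_Mapping.keys f.
        Poly_Mapping.single (char_divisor r v m) (Poly_Mapping.lookup f m))"

text \<open>
  \<open>J\<close> defines \<open>Y\<close> if, under this isomorphism, \<open>Y \<sigma>\<close> is the degree zero
  part of the localization of \<open>J\<close>.
\<close>

definition defines_subscheme ::
    "'a::real_inner set \<Rightarrow> 'a set set \<Rightarrow> nat \<Rightarrow> (nat \<Rightarrow> 'a) \<Rightarrow>
     (divisor \<Rightarrow>\<^sub>0 'k::field) set \<Rightarrow> ('a set \<Rightarrow> ('a \<Rightarrow>\<^sub>0 'k) set) \<Rightarrow> bool" where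
  "defines_subscheme N \<Sigma> r v J Y \<longleftrightarrow>
     (\<forall>\<sigma>\<in>\<Sigma>. Y \<sigma> =
        {f \<in> carrier (chart_ring N \<sigma>). \<exists>k::nat. cox_map r v f * cone_monomial r v \<sigma> ^ k \<in> J})"

text \<open>
  \<open>J\<close> is the ideal \<open>I(Y)\<close>. For reduced \<open>Y\<close> the ideal is normalized as the
  radical \<open>B\<close>-saturated ideal of \<open>Y\<close>, for general \<open>Y\<close> as the
  Pic-generated and Pic-saturated one. The two normalizations may differ for a reduced
  \<open>Y\<close>, where either of them is admitted.
\<close>

definition ideal_of_subscheme ::
    "'a::real_inner set \<Rightarrow> 'a set set \<Rightarrow> nat \<Rightarrow> (nat \<Rightarrow> 'a) \<Rightarrow>
     ('a set \<Rightarrow> ('a \<Rightarrow>\<^sub>0 'k::field) set) \<Rightarrow> (divisor \<Rightarrow>\<^sub>0 'k) set \<Rightarrow> bool" where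
  "ideal_of_subscheme N \<Sigma> r v Y J \<longleftrightarrow>
     ideal J (cox_ring r) \<and>
     homogeneously_generated r (carrier (Cl N r v)) J \<and>
     defines_subscheme N \<Sigma> r v J Y \<and>
     (reduced_subscheme N \<Sigma> Y \<and> radical_ideal J (cox_ring r) \<and>
        J = saturation (cox_ring r) J (irrelevant_ideal \<Sigma> r v)
      \<or>
      homogeneously_generated r (Pic N \<Sigma> r v) J \<and>
        (\<forall>\<alpha>\<in>Pic N \<Sigma> r v. J \<inter> graded_part r \<alpha> =
           saturation (cox_ring r) J (irrelevant_ideal \<Sigma> r v) \<inter> graded_part r \<alpha>))"

text \<open>
  The subscheme \<open>Y\<close> with \<open>J = I(Y)\<close> is a complete intersection in \<open>X\<close>,
  where \<open>dim X = n\<close>. As \<open>X\<close> is an irreducible variety, \<open>codim Y = n - dim Y\<close>.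
\<close>

definition complete_intersection ::
    "'a::real_inner set \<Rightarrow> nat \<Rightarrow> 'a set set \<Rightarrow> nat \<Rightarrow> (nat \<Rightarrow> 'a) \<Rightarrow>
     ('a set \<Rightarrow> ('a \<Rightarrow>\<^sub>0 'k::field) set) \<Rightarrow> (divisor \<Rightarrow>\<^sub>0 'k) set \<Rightarrow> bool" where
  "complete_intersection N n \<Sigma> r v Y J \<longleftrightarrow>
     (\<exists>d k F. has_dimension N \<Sigma> Y d \<and> k + d = n \<and>
        F ` {1..k} \<subseteq> homogeneous_elements r (carrier (Cl N r v)) \<and>
        regular_sequence (cox_ring r) k F \<and> J = Idl\<^bsub>cox_ring r\<^esub> (F ` {1..k}))"

text \<open>
  The dimension of \<open>(S/J)\<^sub>\<alpha>\<close>, the image of \<open>S\<^sub>\<alpha>\<close> in \<open>S/J\<close>, over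
  the image of the field of constants.
\<close>

definition hilbert_function ::
    "nat \<Rightarrow> (divisor \<Rightarrow>\<^sub>0 'k::field) set \<Rightarrow> divisor set \<Rightarrow> nat" where
  "hilbert_function r J \<alpha> =
     ring.dim (cox_ring r Quot J)
       ((\<lambda>c. J +>\<^bsub>cox_ring r\<^esub> Poly_Mapping.single 0 c) ` UNIV)
       ((\<lambda>f. J +>\<^bsub>cox_ring r\<^esub> f) ` graded_part r \<alpha>)"

end

theory Submission
  imports Defs "HOL-Combinatorics.Permutations"
begin

text \<open>
  As \<open>Y\<close> has dimension \<open>0\<close>, the ideal \<open>J = I(Y)\<close> is generated by a
  regular sequence \<open>F\<^sub>1, \<dots>, F\<^sub>n\<close> of homogeneous polynomials, of degrees
  \<open>\<beta>\<^sub>i\<close> say. Put \<open>J\<^sub>k = (F\<^sub>1, \<dots>, F\<^sub>k)\<close>. Multiplication by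
  \<open>F\<^sub>k\<close> gives exact sequences
  \<open>0 \<rightarrow> (S/J\<^sub>k\<^sub>-\<^sub>1)(\<alpha> - \<beta>\<^sub>k) \<rightarrow> (S/J\<^sub>k\<^sub>-\<^sub>1)(\<alpha>) \<rightarrow> (S/J\<^sub>k)(\<alpha>) \<rightarrow> 0\<close>,
  hence the alternating formula with \<open>\<beta>\<^sub>i\<close> in place of \<open>\<alpha>\<^sub>i\<close>; the dimension of
  \<open>S\<^sub>\<alpha>\<close> counts effective divisors in the class \<open>\<alpha>\<close>, i.e. lattice points of
  \<open>P\<^sub>\<alpha>\<close>.

  The given generators \<open>G\<^sub>i\<close> need not be the \<open>F\<^sub>i\<close>, but their degrees agree up to a
  permutation: completeness of the fan makes \<open>S\<close> positively graded with \<open>S\<^sub>0 = K\<close>. Let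
  \<open>m\<close> be the ideal of the variables. The syzygies of a regular sequence have coefficients in
  \<open>J \<subseteq> m\<close>, so the \<open>F\<^sub>i\<close> of a given degree are linearly independent in \<open>J/mJ\<close>,
  while the \<open>G\<^sub>i\<close> of that degree span the corresponding graded part; both families have
  \<open>n\<close> members.
\<close>

section \<open>Linear algebra modulo a subspace\<close>

context vector_space
begin

text \<open>Coefficients are attached to indices rather than to vectors, so \<open>f\<close> may
  repeat values; each induction step splits off one index with
  \<open>span_breakdown_eq\<close>.\<close>

lemma mem_span_Un_image_iff:
  assumes "finite A"
  shows "x \<in> span (B \<union> f ` A) \<longleftrightarrow> (\<exists>c. x - (\<Sum>i\<in>A. scale (c i) (f i)) \<in> span B)"
  using assms
proof (induction A arbitrary: x rule: finite_induct)
  case (insert j A)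
  have "x \<in> span (B \<union> f ` insert j A) \<longleftrightarrow> (\<exists>k. x - scale k (f j) \<in> span (B \<union> f ` A))"
    by (simp add: span_breakdown_eq)
  also have "\<dots> \<longleftrightarrow> (\<exists>k c. x - scale k (f j) - (\<Sum>i\<in>A. scale (c i) (f i)) \<in> span B)"
    using insert.IH by blast
  also have "\<dots> \<longleftrightarrow> (\<exists>c. x - (\<Sum>i\<in>insert j A. scale (c i) (f i)) \<in> span B)" (is "?L \<longleftrightarrow> ?R")
  proof
    assume ?L
    then obtain k c where kc: "x - scale k (f j) - (\<Sum>i\<in>A. scale (c i) (f i)) \<in> span B"
      by blast
    have "(\<Sum>i\<in>insert j A. scale ((c(j := k)) i) (f i)) = scale k (f j) + (\<Sum>i\<in>A. scale (c i) (f i))"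
      using insert.hyps by (auto intro!: sum.cong)
    then have "x - (\<Sum>i\<in>insert j A. scale ((c(j := k)) i) (f i)) \<in> span B"
      using kc by (simp only: diff_diff_add)
    then show ?R
      by blast
  next
    assume ?R
    then show ?L
      using insert.hyps by (auto simp: diff_diff_add)
  qed
  finally show ?case .
qed auto

text \<open>Vectors are adjoined to \<open>B\<close> one at a time: a new vector in the span of the
  earlier ones would give a relation modulo \<open>span B\<close> with coefficient 1. Injectivity
  and disjointness are recorded so that the union can be counted.\<close>

lemma independent_Un_image:
  assumes "finite A" and "independent B"
    and "\<forall>c. (\<Sum>i\<in>A. scale (c i) (f i)) \<in> span B \<longrightarrow> (\<forall>i\<in>A. c i = 0)"
  shows "inj_on f A \<and> f ` A \<inter> B = {} \<and> independent (B \<union> f ` A)"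
  using assms(1,3)
proof (induction A rule: finite_induct)
  case (insert j A)
  have IH: "inj_on f A \<and> f ` A \<inter> B = {} \<and> independent (B \<union> f ` A)"
  proof (rule insert.IH, intro allI impI)
    fix c
    assume c: "(\<Sum>i\<in>A. scale (c i) (f i)) \<in> span B"
    \<comment> \<open>A relation over \<open>A\<close> becomes one over \<open>insert j A\<close> by
      giving \<open>j\<close> the coefficient 0.\<close>
    have "(\<Sum>i\<in>insert j A. scale ((c(j := 0)) i) (f i)) = (\<Sum>i\<in>A. scale (c i) (f i))"
      using insert.hyps by (intro sum.mono_neutral_cong_right) auto
    then have "(\<Sum>i\<in>insert j A. scale ((c(j := 0)) i) (f i)) \<in> span B"
      using c by (rule ssubst)
    then have c0: "\<forall>i\<in>insert j A. (c(j := 0)) i = 0"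
      by (rule mp[OF spec[OF insert.prems]])
    show "\<forall>i\<in>A. c i = 0"
    proof
      fix i
      assume i: "i \<in> A"
      then have "(c(j := 0)) i = 0"
        using c0 by blast
      then show "c i = 0"
        using i insert.hyps(2) by (metis fun_upd_other)
    qed
  qed
  have new: "f j \<notin> span (B \<union> f ` A)"
  proof
    assume "f j \<in> span (B \<union> f ` A)"
    then obtain c where c: "f j - (\<Sum>i\<in>A. scale (c i) (f i)) \<in> span B"
      using mem_span_Un_image_iff[OF insert.hyps(1)] by blast
    \<comment> \<open>The forbidden relation has coefficient 1 at \<open>j\<close> and
      \<open>- c i\<close> elsewhere.\<close>
    have "(\<Sum>i\<in>insert j A. scale (((\<lambda>i. - c i)(j := 1)) i) (f i)) = f j + (\<Sum>i\<in>A. - (scale (c i) (f i)))"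
      using insert.hyps by (auto intro!: sum.cong)
    then have "(\<Sum>i\<in>insert j A. scale (((\<lambda>i. - c i)(j := 1)) i) (f i)) \<in> span B"
      using c by (simp add: sum_negf)
    then have "\<forall>i\<in>insert j A. ((\<lambda>i. - c i)(j := 1)) i = 0"
      by (rule mp[OF spec[OF insert.prems]])
    then show False
      by simp
  qed
  then have notin: "f j \<notin> B \<union> f ` A"
    using span_base[of "f j" "B \<union> f ` A"] by blast
  have "independent (insert (f j) (B \<union> f ` A))"
    using IH new by (simp add: independent_insertI)
  moreover have "insert (f j) (B \<union> f ` A) = B \<union> f ` insert j A"
    by blast
  moreover have "inj_on f (insert j A)" "f ` insert j A \<inter> B = {}"
    using IH notin by (auto simp: inj_on_insert)
  ultimately show ?case
    by metis
qed (use assms(2) in auto)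

text \<open>\<open>Z\<close> is what a basis of \<open>U\<close> gains when it is extended to one of
  \<open>V\<close>. The last two conclusions let \<open>V\<close> modulo \<open>U\<close> be handled
  without forming a quotient space.\<close>

lemma exists_complement_basis:
  assumes "subspace U" and "U \<subseteq> V" and "V \<subseteq> span T" and "finite T"
  obtains Z where "finite Z" and "Z \<subseteq> V" and "dim V = dim U + card Z"
    and "\<And>c. (\<Sum>z\<in>Z. scale (c z) z) \<in> U \<Longrightarrow> \<forall>z\<in>Z. c z = 0"
    and "\<And>x. x \<in> V \<Longrightarrow> \<exists>c. x - (\<Sum>z\<in>Z. scale (c z) z) \<in> U"
proof -
  obtain A where A: "A \<subseteq> U" "independent A" "U \<subseteq> span A" "card A = dim U"
    by (rule basis_exists[of U])
  then obtain B where B: "A \<subseteq> B" "B \<subseteq> V" "independent B" "V \<subseteq> span B"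
    using maximal_independent_subset_extend[of A V] assms(2) by blast
  have fin: "finite B"
    using independent_span_bound[OF assms(4) B(3)] B(2) assms(3) by (meson subset_trans)
  have span_A: "span A = U"
    using A assms(1) span_minimal by blast
  have "finite (B - A)" "B - A \<subseteq> V"
    using fin B by auto
  moreover have "dim V = dim U + card (B - A)"
  proof -
    have "card B = dim V"
      using B basis_card_eq_dim by blast
    moreover have "card B = card A + card (B - A)"
      using fin B(1) by (metis card_Diff_subset card_mono finite_subset le_add_diff_inverse)
    ultimately show ?thesis
      using A by simp
  qed
  moreover have "\<forall>z\<in>B - A. c z = 0" if c: "(\<Sum>z\<in>B - A. scale (c z) z) \<in> U" for c
  proof -
    have "finite A"
      using fin B finite_subset by blast
    then obtain u where u: "(\<Sum>z\<in>B - A. scale (c z) z) = (\<Sum>z\<in>A. scale (u z) z)"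
      using c span_A span_finite by auto
    \<comment> \<open>Subtracting the expansion \<open>u\<close> in the basis of \<open>U\<close>
      turns the hypothesis into a relation among the independent vectors of
      \<open>B\<close>.\<close>
    have "(\<Sum>z\<in>B. scale (if z \<in> A then - u z else c z) z)
        = (\<Sum>z\<in>B - A. scale (if z \<in> A then - u z else c z) z)
          + (\<Sum>z\<in>A. scale (if z \<in> A then - u z else c z) z)"
      using B(1) fin by (rule sum.subset_diff)
    also have "\<dots> = (\<Sum>z\<in>B - A. scale (c z) z) + (\<Sum>z\<in>A. - (scale (u z) z))"
      by (intro arg_cong2[where f = "(+)"] sum.cong) auto
    also have "\<dots> = 0"
      using u by (simp add: sum_negf)
    finally have "\<forall>z\<in>B. (if z \<in> A then - u z else c z) = 0"
      using independentD[OF B(3) fin subset_refl, where u = "\<lambda>z. if z \<in> A then - u z else c z"] by blast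
    then show ?thesis
      by auto
  qed
  moreover have "\<exists>c. x - (\<Sum>z\<in>B - A. scale (c z) z) \<in> U" if "x \<in> V" for x
  proof -
    have "A \<union> (\<lambda>z. z) ` (B - A) = B"
      using B(1) by auto
    then have "x \<in> span (A \<union> (\<lambda>z. z) ` (B - A))"
      using that B(4) by auto
    then show ?thesis
      using mem_span_Un_image_iff[of "B - A" x A "\<lambda>z. z"] fin span_A by (simp only: finite_Diff)
  qed
  ultimately show thesis
    by (intro that[of "B - A"])
qed

end

section \<open>Graded algebras of pointed monoids\<close>

text \<open>Scalars act through constant polynomials, so linear algebra over \<open>'k\<close> and
  ring multiplication are compatible by associativity alone.\<close>

global_interpretation pm: vector_space
  "\<lambda>(c::'k::field) (f::'g::comm_monoid_add \<Rightarrow>\<^sub>0 'k). Poly_Mapping.single 0 c * f"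
proof
  show "Poly_Mapping.single 0 (a + b) * x = Poly_Mapping.single 0 a * x + Poly_Mapping.single 0 b * x"
    for a b :: 'k and x :: "'g \<Rightarrow>\<^sub>0 'k"
    by (simp add: single_add distrib_right)
  show "Poly_Mapping.single 0 a * (Poly_Mapping.single 0 b * x) = Poly_Mapping.single 0 (a * b) * x"
    for a b :: 'k and x :: "'g \<Rightarrow>\<^sub>0 'k"
    by (simp add: mult_single flip: mult.assoc)
qed (simp_all add: distrib_left single_one)

text \<open>\<open>E\<close> is the monoid of exponents and \<open>H\<close> the group of exponents
  of degree zero: the degree group is \<open>'g\<close> modulo \<open>H\<close>, and a degree is
  always given by a representative \<open>a\<close>. \<open>E_Int_H\<close> makes the constants the
  only elements of degree zero, and \<open>finite_degree\<close> makes the graded pieces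
  finite-dimensional.\<close>

locale graded_monoid_algebra =
  fixes E H :: "'g::ab_group_add set"
  assumes zero_E: "0 \<in> E" and add_E: "\<And>x y. x \<in> E \<Longrightarrow> y \<in> E \<Longrightarrow> x + y \<in> E"
    and pointed: "\<And>x. x \<in> E \<Longrightarrow> - x \<in> E \<Longrightarrow> x = 0"
    and zero_H: "0 \<in> H" and add_H: "\<And>x y. x \<in> H \<Longrightarrow> y \<in> H \<Longrightarrow> x + y \<in> H"
    and uminus_H: "\<And>x. x \<in> H \<Longrightarrow> - x \<in> H"
    and E_Int_H: "\<And>x. x \<in> E \<Longrightarrow> x \<in> H \<Longrightarrow> x = 0"
    and finite_degree: "\<And>a. finite {x \<in> E. x - a \<in> H}"
begin

lemma diff_H: "x \<in> H \<Longrightarrow> y \<in> H \<Longrightarrow> x - y \<in> H"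
  using add_H[of x "- y"] uminus_H by simp

lemma diff_H_iff: "x - y \<in> H \<Longrightarrow> x \<in> H \<longleftrightarrow> y \<in> H"
  using add_H[of "x - y" y] diff_H[of x "x - y"] by auto

definition alg :: "('g \<Rightarrow>\<^sub>0 'k::field) set" where
  "alg = {f. Poly_Mapping.keys f \<subseteq> E}"

text \<open>The span of the nonconstant monomials; in the coordinate ring this is the ideal m of the
  variables.\<close>

definition max_ideal :: "('g \<Rightarrow>\<^sub>0 'k::field) set" where
  "max_ideal = {f \<in> alg. Poly_Mapping.lookup f 0 = 0}"

definition hom :: "'g \<Rightarrow> ('g \<Rightarrow>\<^sub>0 'k::field) set" where
  "hom a = {f. \<forall>x\<in>Poly_Mapping.keys f. x \<in> E \<and> x - a \<in> H}"

text \<open>The homogeneous component in the degree represented by \<open>a\<close>.\<close>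

definition part :: "'g \<Rightarrow> ('g \<Rightarrow>\<^sub>0 'k::field) \<Rightarrow> ('g \<Rightarrow>\<^sub>0 'k)" where
  "part a f = (\<Sum>x\<in>{x \<in> Poly_Mapping.keys f. x - a \<in> H}. Poly_Mapping.single x (Poly_Mapping.lookup f x))"

definition graded_ideal :: "('g \<Rightarrow>\<^sub>0 'k::field) set \<Rightarrow> bool" where
  "graded_ideal A \<longleftrightarrow> A \<subseteq> alg \<and> 0 \<in> A \<and> (\<forall>f\<in>A. \<forall>g\<in>A. f + g \<in> A) \<and>
     (\<forall>f\<in>A. \<forall>g\<in>alg. g * f \<in> A) \<and> (\<forall>f\<in>A. \<forall>a. part a f \<in> A)"

text \<open>For \<open>A = alg\<close> this is the ideal (F_1, ..., F_n), for
  \<open>A = max_ideal\<close> it is m times that ideal; one definition serves both.\<close>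

definition gen :: "('g \<Rightarrow>\<^sub>0 'k::field) set \<Rightarrow> (nat \<Rightarrow> 'g \<Rightarrow>\<^sub>0 'k) \<Rightarrow> nat \<Rightarrow> ('g \<Rightarrow>\<^sub>0 'k) set" where
  "gen A F n = {\<Sum>i\<in>{1..n}. h i * F i |h. \<forall>i\<in>{1..n}. h i \<in> A}"

text \<open>This is the nonzerodivisor condition; properness of the ideal is carried separately as
  \<open>1 \<notin> gen alg F n\<close>.\<close>

definition regular_seq :: "(nat \<Rightarrow> 'g \<Rightarrow>\<^sub>0 'k::field) \<Rightarrow> nat \<Rightarrow> bool" where
  "regular_seq F n \<longleftrightarrow> (\<forall>i<n. \<forall>g\<in>alg. g * F (Suc i) \<in> gen alg F i \<longrightarrow> g \<in> gen alg F i)"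

section \<open>Homogeneous components\<close>

lemma lookup_part: "Poly_Mapping.lookup (part a f) x = (if x - a \<in> H then Poly_Mapping.lookup f x else 0)"
proof -
  have "Poly_Mapping.lookup (part a f) x
      = (\<Sum>y\<in>{y \<in> Poly_Mapping.keys f. y - a \<in> H}. if y = x then Poly_Mapping.lookup f y else 0)"
    by (auto simp: part_def lookup_sum lookup_single when_def intro!: sum.cong)
  then show ?thesis
    by (auto simp: sum.delta in_keys_iff)
qed

lemma part_add: "part a (f + g) = part a f + part a g"
  by (rule poly_mapping_eqI) (simp add: lookup_part lookup_add)

lemma part_zero: "part a 0 = 0"
  by (rule poly_mapping_eqI) (simp add: lookup_part)

lemma part_sum: "part a (sum f I) = (\<Sum>i\<in>I. part a (f i))"
  by (induction I rule: infinite_finite_induct) (auto simp: part_add part_zero)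

lemma part_eq_self: "(\<And>x. x \<in> Poly_Mapping.keys f \<Longrightarrow> x - a \<in> H) \<Longrightarrow> part a f = f"
  by (rule poly_mapping_eqI) (auto simp: lookup_part in_keys_iff)

lemma part_eq_0: "(\<And>x. x \<in> Poly_Mapping.keys f \<Longrightarrow> x - a \<notin> H) \<Longrightarrow> part a f = 0"
  by (rule poly_mapping_eqI) (auto simp: lookup_part in_keys_iff)

lemma keys_part: "Poly_Mapping.keys (part a f) = {x \<in> Poly_Mapping.keys f. x - a \<in> H}"
  by (auto simp: in_keys_iff lookup_part split: if_splits)

lemma part_hom: "f \<in> hom a \<Longrightarrow> part a f = f"
  by (rule part_eq_self) (auto simp: hom_def)

lemma part_in_hom: "f \<in> alg \<Longrightarrow> part a f \<in> hom a"
  by (auto simp: hom_def alg_def keys_part)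

text \<open>Split \<open>h\<close> into its component of degree \<open>a - b\<close> and the rest.
  The first times \<open>g\<close> lies in degree \<open>a\<close>; as degrees form a group, the
  second times \<open>g\<close> has no exponent of degree \<open>a\<close>.\<close>

lemma part_mult:
  assumes "g \<in> hom b"
  shows "part a (h * g) = part (a - b) h * g"
proof -
  let ?h = "part (a - b) h"
  have "part a (?h * g) = ?h * g"
  proof (rule part_eq_self)
    fix x assume "x \<in> Poly_Mapping.keys (?h * g)"
    then obtain y z where yz: "x = y + z" "y \<in> Poly_Mapping.keys ?h" "z \<in> Poly_Mapping.keys g"
      using keys_mult by blast
    then have "y - (a - b) \<in> H" "z - b \<in> H"
      using assms by (auto simp: keys_part hom_def)
    then have "y - (a - b) + (z - b) \<in> H"
      by (rule add_H)
    then show "x - a \<in> H"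
      using yz by (simp add: algebra_simps)
  qed
  moreover have "part a ((h - ?h) * g) = 0"
  proof (rule part_eq_0)
    fix x assume "x \<in> Poly_Mapping.keys ((h - ?h) * g)"
    then obtain y z where yz: "x = y + z" "y \<in> Poly_Mapping.keys (h - ?h)" "z \<in> Poly_Mapping.keys g"
      using keys_mult by blast
    then have y: "y - (a - b) \<notin> H" and z: "z - b \<in> H"
      using assms by (auto simp: in_keys_iff lookup_minus lookup_part hom_def)
    have "y - (a - b) = x - a - (z - b)"
      using yz by (simp add: algebra_simps)
    then show "x - a \<notin> H"
      using y z diff_H by metis
  qed
  ultimately show ?thesis
    using part_add[of a "?h * g" "(h - ?h) * g"] by (simp flip: distrib_right)
qed

section \<open>The algebra, its graded pieces and constant terms\<close>

lemma alg_add: "f \<in> alg \<Longrightarrow> g \<in> alg \<Longrightarrow> f + g \<in> alg"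
  using keys_add[of f g] by (auto simp: alg_def)

lemma alg_uminus: "f \<in> alg \<Longrightarrow> - f \<in> alg"
  by (simp add: alg_def)

lemma alg_mult: "f \<in> alg \<Longrightarrow> g \<in> alg \<Longrightarrow> f * g \<in> alg"
  using keys_mult[of f g] by (force simp: alg_def intro: add_E)

lemma alg_single: "x \<in> E \<Longrightarrow> Poly_Mapping.single x c \<in> alg"
  by (simp add: alg_def)

lemma alg_const: "Poly_Mapping.single 0 c \<in> alg"
  by (simp add: alg_single zero_E)

lemma alg_one: "1 \<in> alg"
  by (simp add: alg_def zero_E)

lemma hom_subset_alg: "hom a \<subseteq> alg"
  by (auto simp: hom_def alg_def)

lemma hom_mult: "f \<in> hom a \<Longrightarrow> g \<in> hom b \<Longrightarrow> f * g \<in> hom (a + b)"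
  using part_mult[of g b "a + b" f] part_hom[of f a] part_in_hom[of "f * g" "a + b"]
    alg_mult[of f g] hom_subset_alg by (metis add_diff_cancel_right' subsetD)

lemma hom_eqI:
  assumes "a - b \<in> H"
  shows "hom a = hom b"
proof -
  have "x - a \<in> H \<longleftrightarrow> x - b \<in> H" for x
    using diff_H_iff[of "x - b" "x - a"] assms by (simp add: algebra_simps)
  then show ?thesis
    by (simp add: hom_def)
qed

lemma graded_ideal_alg: "graded_ideal alg"
  unfolding graded_ideal_def
proof (intro conjI ballI allI)
  show "part a f \<in> alg" if "f \<in> alg" for f a
    using part_in_hom[OF that] hom_subset_alg by blast
qed (auto intro: alg_add alg_mult, simp add: alg_def)

text \<open>By \<open>pointed\<close>, two exponents add up to 0 only if both are 0, so only the
  constant terms contribute. The proof subtracts from \<open>g\<close> its constant term, after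
  which the product has none.\<close>

lemma lookup_0_mult:
  assumes "f \<in> alg" and "g \<in> alg"
  shows "Poly_Mapping.lookup (f * g) 0 = Poly_Mapping.lookup f 0 * Poly_Mapping.lookup g 0"
proof -
  have *: "Poly_Mapping.lookup (f * h) 0 = 0"
    if "h \<in> alg" "Poly_Mapping.lookup h 0 = 0" for h
  proof (rule ccontr)
    assume "Poly_Mapping.lookup (f * h) 0 \<noteq> 0"
    then have "0 \<in> Poly_Mapping.keys (f * h)"
      by (simp add: in_keys_iff)
    then obtain x y where xy: "0 = x + y" "x \<in> Poly_Mapping.keys f" "y \<in> Poly_Mapping.keys h"
      using keys_mult by blast
    then have "- y \<in> E" "y \<in> E"
      using assms(1) that(1) eq_neg_iff_add_eq_0[of x y] by (auto simp: alg_def)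
    then have "y = 0"
      using pointed by blast
    then show False
      using xy(3) that(2) by (simp add: in_keys_iff)
  qed
  let ?c = "Poly_Mapping.single 0 (Poly_Mapping.lookup g 0)"
  have "g - ?c \<in> alg"
    using alg_add[OF assms(2) alg_uminus[OF alg_const]] by simp
  then have "Poly_Mapping.lookup (f * (g - ?c)) 0 = 0"
    by (rule *) (simp add: lookup_minus)
  then have "Poly_Mapping.lookup (f * g) 0 = Poly_Mapping.lookup (f * ?c) 0"
    by (simp add: right_diff_distrib lookup_minus)
  also have "f * ?c = Poly_Mapping.map ((*) (Poly_Mapping.lookup g 0)) f"
    by (simp add: mult.commute mult_map_scale_conv_mult)
  finally show ?thesis
    by (simp add: map.rep_eq when_def)
qed

lemma graded_ideal_max_ideal: "graded_ideal max_ideal"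
  unfolding graded_ideal_def
proof (intro conjI ballI allI)
  show "part a f \<in> max_ideal" if "f \<in> max_ideal" for f a
    using that part_in_hom[of f a] hom_subset_alg by (auto simp: max_ideal_def lookup_part)
qed (auto simp: max_ideal_def lookup_add lookup_0_mult intro: alg_add alg_mult, simp add: alg_def)

lemma graded_ideal_mult: "graded_ideal A \<Longrightarrow> f \<in> A \<Longrightarrow> g \<in> alg \<Longrightarrow> g * f \<in> A"
  by (simp add: graded_ideal_def)

lemma graded_ideal_sum: "graded_ideal A \<Longrightarrow> (\<And>i. i \<in> I \<Longrightarrow> f i \<in> A) \<Longrightarrow> sum f I \<in> A"
  by (induction I rule: infinite_finite_induct) (auto simp: graded_ideal_def)

lemma graded_ideal_uminus:
  assumes "graded_ideal A" and "f \<in> A"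
  shows "- f \<in> A"
  using graded_ideal_mult[OF assms alg_uminus[OF alg_one]] by simp

lemma subspace_graded_ideal: "graded_ideal A \<Longrightarrow> pm.subspace A"
  by (auto simp: pm.subspace_def graded_ideal_def alg_const)

lemma subspace_hom: "pm.subspace (hom a)"
proof -
  have "Poly_Mapping.single 0 c * f \<in> hom a" if "f \<in> hom a" for c f
  proof -
    have "Poly_Mapping.single 0 c \<in> hom 0"
      by (simp add: hom_def zero_E zero_H)
    from hom_mult[OF this that] show ?thesis
      by simp
  qed
  moreover have "f + g \<in> hom a" if "f \<in> hom a" "g \<in> hom a" for f g
    using keys_add[of f g] that by (auto simp: hom_def)
  moreover have "0 \<in> hom a"
    by (simp add: hom_def)
  ultimately show ?thesis
    unfolding pm.subspace_def by blast
qed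

lemma mem_hom_diff: "f \<in> hom a \<Longrightarrow> g \<in> hom a \<Longrightarrow> f - g \<in> hom a"
  using pm.subspace_diff[OF subspace_hom] .

section \<open>Ideals generated by homogeneous sequences\<close>

lemma genI: "(\<And>i. i \<in> {1..n} \<Longrightarrow> h i \<in> A) \<Longrightarrow> (\<Sum>i\<in>{1..n}. h i * F i) \<in> gen A F n"
  by (auto simp: gen_def)

lemma genE:
  assumes "f \<in> gen A F n"
  obtains h where "f = (\<Sum>i\<in>{1..n}. h i * F i)" and "\<And>i. i \<in> {1..n} \<Longrightarrow> h i \<in> A"
  using assms unfolding gen_def by blast

text \<open>The point is closure under \<open>part\<close>: as each \<open>F i\<close> is
  homogeneous, a component of a combination is the combination of components of the coefficients,
  which stay in \<open>A\<close>.\<close>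

lemma graded_ideal_gen:
  fixes A :: "('g \<Rightarrow>\<^sub>0 'k::field) set"
  assumes "graded_ideal A" and "\<And>i. i \<in> {1..n} \<Longrightarrow> F i \<in> hom (b i)"
  shows "graded_ideal (gen A F n)"
  unfolding graded_ideal_def
proof (intro conjI ballI allI subsetI)
  have F: "F i \<in> alg" if "i \<in> {1..n}" for i
    using assms(2)[OF that] hom_subset_alg by blast
  show "f \<in> alg" if f: "f \<in> gen A F n" for f
  proof -
    obtain h where "f = (\<Sum>i\<in>{1..n}. h i * F i)" "\<forall>i\<in>{1..n}. h i \<in> A"
      using f by (auto simp: gen_def)
    then show ?thesis
      using F assms(1) by (auto simp: graded_ideal_def intro!: graded_ideal_sum[OF graded_ideal_alg] alg_mult)
  qed
  show "0 \<in> gen A F n"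
    using genI[of n "\<lambda>_. 0" A F] assms(1) by (simp add: graded_ideal_def)
next
  fix f g :: "'g \<Rightarrow>\<^sub>0 'k" assume "f \<in> gen A F n" "g \<in> gen A F n"
  then obtain h h' where h: "f = (\<Sum>i\<in>{1..n}. h i * F i)" "\<forall>i\<in>{1..n}. h i \<in> A"
    and h': "g = (\<Sum>i\<in>{1..n}. h' i * F i)" "\<forall>i\<in>{1..n}. h' i \<in> A"
    by (auto simp: gen_def)
  have "f + g = (\<Sum>i\<in>{1..n}. (h i + h' i) * F i)" "\<forall>i\<in>{1..n}. h i + h' i \<in> A"
    using h h' assms(1) by (simp_all add: distrib_right sum.distrib graded_ideal_def)
  then show "f + g \<in> gen A F n"
    by (simp only:) (intro genI, blast)
next
  fix f g :: "'g \<Rightarrow>\<^sub>0 'k" assume "f \<in> gen A F n" and g: "g \<in> alg"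
  then obtain h where h: "f = (\<Sum>i\<in>{1..n}. h i * F i)" "\<forall>i\<in>{1..n}. h i \<in> A"
    by (auto simp: gen_def)
  have "g * f = (\<Sum>i\<in>{1..n}. (g * h i) * F i)" "\<forall>i\<in>{1..n}. g * h i \<in> A"
    using h g assms(1) by (simp_all add: sum_distrib_left mult.assoc graded_ideal_def)
  then show "g * f \<in> gen A F n"
    by (simp only:) (intro genI, blast)
next
  fix f a assume "f \<in> gen A F n"
  then obtain h where h: "f = (\<Sum>i\<in>{1..n}. h i * F i)" "\<forall>i\<in>{1..n}. h i \<in> A"
    by (auto simp: gen_def)
  have "part a f = (\<Sum>i\<in>{1..n}. part (a - b i) (h i) * F i)" "\<forall>i\<in>{1..n}. part (a - b i) (h i) \<in> A"
    using h assms by (auto simp: part_sum graded_ideal_def intro!: sum.cong part_mult)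
  then show "part a f \<in> gen A F n"
    by (simp only:) (intro genI, blast)
qed

text \<open>Applying \<open>part a\<close> to any representation makes the coefficients homogeneous
  and leaves \<open>f\<close> unchanged.\<close>

lemma gen_Int_homE:
  assumes "graded_ideal A" and "\<And>i. i \<in> {1..n} \<Longrightarrow> F i \<in> hom (b i)" and "f \<in> gen A F n" and "f \<in> hom a"
  obtains h where "f = (\<Sum>i\<in>{1..n}. h i * F i)" and "\<And>i. i \<in> {1..n} \<Longrightarrow> h i \<in> A"
    and "\<And>i. i \<in> {1..n} \<Longrightarrow> h i \<in> hom (a - b i)"
proof -
  obtain h where h: "f = (\<Sum>i\<in>{1..n}. h i * F i)" "\<forall>i\<in>{1..n}. h i \<in> A"
    using assms(3) by (auto simp: gen_def)
  have "f = part a f"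
    using assms(4) by (simp add: part_hom)
  also have "\<dots> = (\<Sum>i\<in>{1..n}. part (a - b i) (h i) * F i)"
    using h assms(2) by (auto simp: part_sum intro!: sum.cong part_mult)
  finally show thesis
    using h(2) assms(1) by (intro that[of "\<lambda>i. part (a - b i) (h i)"]) (auto simp: graded_ideal_def intro!: part_in_hom)
qed

lemma gen_Suc: "gen A F (Suc n) = {x + h * F (Suc n) |x h. x \<in> gen A F n \<and> h \<in> A}"
proof -
  have "x + h * F (Suc n) \<in> gen A F (Suc n)" if x: "x \<in> gen A F n" and h: "h \<in> A" for x h
  proof -
    obtain g where g: "x = (\<Sum>i\<in>{1..n}. g i * F i)" "\<forall>i\<in>{1..n}. g i \<in> A"
      using x by (auto simp: gen_def)
    have "x + h * F (Suc n) = (\<Sum>i\<in>{1..Suc n}. (g(Suc n := h)) i * F i)"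
      using g by simp
    moreover have "\<forall>i\<in>{1..Suc n}. (g(Suc n := h)) i \<in> A"
      using g h by auto
    ultimately show ?thesis
      unfolding gen_def by blast
  qed
  moreover have "\<exists>x h. f = x + h * F (Suc n) \<and> x \<in> gen A F n \<and> h \<in> A" if f: "f \<in> gen A F (Suc n)" for f
  proof -
    obtain h where "f = (\<Sum>i\<in>{1..Suc n}. h i * F i)" "\<forall>i\<in>{1..Suc n}. h i \<in> A"
      using f by (auto simp: gen_def)
    then have "f = (\<Sum>i\<in>{1..n}. h i * F i) + h (Suc n) * F (Suc n)"
      and "(\<Sum>i\<in>{1..n}. h i * F i) \<in> gen A F n" and "h (Suc n) \<in> A"
      by (auto simp: gen_def)
    then show ?thesis
      by blast
  qed
  ultimately show ?thesis
    by blast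
qed

section \<open>Dimensions of graded pieces and of quotients by a regular sequence\<close>

lemma hom_subset_span: "(hom a :: ('g \<Rightarrow>\<^sub>0 'k::field) set) \<subseteq> pm.span ((\<lambda>x. Poly_Mapping.single x 1) ` {x \<in> E. x - a \<in> H})"
proof
  fix f :: "'g \<Rightarrow>\<^sub>0 'k"
  assume f: "f \<in> hom a"
  have "f = part a f"
    using f by (simp add: part_hom)
  also have "\<dots> = (\<Sum>x\<in>{x \<in> Poly_Mapping.keys f. x - a \<in> H}.
      Poly_Mapping.single 0 (Poly_Mapping.lookup f x) * Poly_Mapping.single x 1)"
    by (simp add: part_def mult_single)
  also have "\<dots> \<in> pm.span ((\<lambda>x. Poly_Mapping.single x 1) ` {x \<in> E. x - a \<in> H})"
    using f by (intro pm.span_sum pm.span_scale pm.span_base) (auto simp: hom_def)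
  finally show "f \<in> pm.span ((\<lambda>x. Poly_Mapping.single x 1) ` {x \<in> E. x - a \<in> H})" .
qed

text \<open>The monomials with these exponents form a basis; their independence is taken modulo the
  zero space, with \<open>B = {}\<close>.\<close>

lemma dim_hom: "pm.dim (hom a :: ('g \<Rightarrow>\<^sub>0 'k::field) set) = card {x \<in> E. x - a \<in> H}"
proof -
  let ?X = "{x \<in> E. x - a \<in> H}" and ?m = "\<lambda>x. Poly_Mapping.single x (1::'k)"
  have "inj_on ?m ?X \<and> ?m ` ?X \<inter> {} = {} \<and> pm.independent ({} \<union> ?m ` ?X)"
  proof (intro pm.independent_Un_image allI impI ballI)
    fix c y
    assume "(\<Sum>x\<in>?X. Poly_Mapping.single 0 (c x) * ?m x) \<in> pm.span {}" and y: "y \<in> ?X"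
    then have "Poly_Mapping.lookup (\<Sum>x\<in>?X. Poly_Mapping.single x (c x)) y = 0"
      by (simp add: mult_single)
    then have "(\<Sum>x\<in>?X. if x = y then c x else 0) = 0"
      by (simp add: lookup_sum lookup_single when_def)
    then show "c y = 0"
      using y finite_degree[of a] by (simp add: sum.delta)
  qed (simp_all add: finite_degree pm.independent_empty)
  moreover have "?m ` ?X \<subseteq> hom a"
    by (auto simp: hom_def)
  ultimately show ?thesis
    using hom_subset_span by (intro pm.dim_unique[of "?m ` ?X"]) (auto simp: card_image)
qed

lemma gen_mono_Suc: "graded_ideal A \<Longrightarrow> gen A F n \<subseteq> gen A F (Suc n)"
  by (force simp: gen_Suc graded_ideal_def)

lemma gen_Suc_I: "graded_ideal A \<Longrightarrow> h \<in> A \<Longrightarrow> h * F (Suc n) \<in> gen A F (Suc n)"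
proof -
  assume A: "graded_ideal A" and h: "h \<in> A"
  have "0 \<in> gen A F n"
    using genI[of n "\<lambda>_. 0" A F] A by (simp add: graded_ideal_def)
  then have "0 + h * F (Suc n) \<in> gen A F (Suc n)"
    unfolding gen_Suc using h by blast
  then show ?thesis
    by simp
qed

text \<open>This is the dimension count of the exact sequence for multiplication by
  \<open>F (Suc n)\<close>, phrased for ideals and without subtraction. If \<open>Z\<close> is a
  basis of a complement of J_n in degree \<open>a - b (Suc n)\<close>, then the degree
  \<open>a\<close> piece of the larger ideal is that of J_n plus, directly, the span of
  \<open>Z\<close> times \<open>F (Suc n)\<close>.\<close>

lemma dim_gen_Suc:
  fixes F :: "nat \<Rightarrow> 'g \<Rightarrow>\<^sub>0 'k::field"
  assumes F: "\<And>i. i \<in> {1..Suc n} \<Longrightarrow> F i \<in> hom (b i)" and reg: "regular_seq F (Suc n)"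
  shows "pm.dim (gen alg F (Suc n) \<inter> hom a) + pm.dim (gen alg F n \<inter> hom (a - b (Suc n)))
    = pm.dim (gen alg F n \<inter> hom a) + pm.dim (hom (a - b (Suc n)) :: ('g \<Rightarrow>\<^sub>0 'k) set)"
proof -
  let ?f = "F (Suc n)" and ?a' = "a - b (Suc n)"
  let ?U = "gen alg F n \<inter> hom a" and ?U' = "gen alg F n \<inter> hom ?a'"
  let ?W = "gen alg F (Suc n) \<inter> hom a"
  have f: "?f \<in> hom (b (Suc n))" "?f \<in> alg"
    using F[of "Suc n"] hom_subset_alg by auto
  have ideal: "graded_ideal (gen alg F n)"
    using F by (intro graded_ideal_gen[OF graded_ideal_alg, of n F b]) auto
  have sub: "pm.subspace ?U" "pm.subspace ?U'"
    by (intro pm.subspace_inter subspace_graded_ideal[OF ideal] subspace_hom)+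
  obtain Z where Z: "finite Z" "Z \<subseteq> hom ?a'" "pm.dim (hom ?a' :: ('g \<Rightarrow>\<^sub>0 'k) set) = pm.dim ?U' + card Z"
    and Z_indep: "\<And>c. (\<Sum>z\<in>Z. Poly_Mapping.single 0 (c z) * z) \<in> ?U' \<Longrightarrow> \<forall>z\<in>Z. c z = 0"
    and Z_span: "\<And>x. x \<in> hom ?a' \<Longrightarrow> \<exists>c. x - (\<Sum>z\<in>Z. Poly_Mapping.single 0 (c z) * z) \<in> ?U'"
    by (rule pm.exists_complement_basis[OF sub(2) Int_lower2 hom_subset_span]) (auto simp: finite_degree)
  obtain B where B: "B \<subseteq> ?U" "pm.independent B" "?U \<subseteq> pm.span B" "card B = pm.dim ?U"
    by (rule pm.basis_exists)
  have "B \<subseteq> pm.span ((\<lambda>x. Poly_Mapping.single x 1) ` {x \<in> E. x - a \<in> H})"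
    using B(1) hom_subset_span by blast
  then have finB: "finite B"
    using pm.independent_span_bound[OF _ B(2)] finite_degree[of a] by blast
  have span_B: "pm.span B = ?U"
    using B(1,3) pm.span_minimal[OF B(1) sub(1)] by blast
  have hom_mult_f: "z * ?f \<in> hom a" if "z \<in> hom ?a'" for z
    using hom_mult[OF that f(1)] by simp
  have scale_f: "(\<Sum>z\<in>Z. Poly_Mapping.single 0 (c z) * (z * ?f))
      = (\<Sum>z\<in>Z. Poly_Mapping.single 0 (c z) * z) * ?f" for c
    by (simp add: sum_distrib_right mult.assoc)
  have in_hom: "(\<Sum>z\<in>Z. Poly_Mapping.single 0 (c z) * z) \<in> hom ?a'" for c
    using Z(2) by (intro pm.subspace_sum[OF subspace_hom] pm.subspace_scale[OF subspace_hom]) auto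
  \<comment> \<open>Regularity cancels \<open>?f\<close> modulo \<open>gen alg F n\<close>, and then
    the complement property of \<open>Z\<close> kills the coefficients.\<close>
  have indep: "inj_on (\<lambda>z. z * ?f) Z \<and> (\<lambda>z. z * ?f) ` Z \<inter> B = {}
      \<and> pm.independent (B \<union> (\<lambda>z. z * ?f) ` Z)"
  proof (intro pm.independent_Un_image[OF Z(1) B(2)] allI impI)
    fix c
    assume "(\<Sum>z\<in>Z. Poly_Mapping.single 0 (c z) * (z * ?f)) \<in> pm.span B"
    then have "(\<Sum>z\<in>Z. Poly_Mapping.single 0 (c z) * z) * ?f \<in> gen alg F n"
      unfolding span_B scale_f by blast
    then have "(\<Sum>z\<in>Z. Poly_Mapping.single 0 (c z) * z) \<in> gen alg F n"
      using reg in_hom hom_subset_alg unfolding regular_seq_def by blast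
    then show "\<forall>z\<in>Z. c z = 0"
      using in_hom by (intro Z_indep) blast
  qed
  \<comment> \<open>Write \<open>w\<close> as \<open>x + h (Suc n) * ?f\<close> with homogeneous
    \<open>h (Suc n)\<close>, and replace the latter by a combination of \<open>Z\<close>: the error
    lies in \<open>?U'\<close>, so after multiplication by \<open>?f\<close> it is absorbed into
    \<open>?U\<close>.\<close>
  have "?W \<subseteq> pm.span (B \<union> (\<lambda>z. z * ?f) ` Z)"
  proof
    fix w assume w: "w \<in> ?W"
    obtain h where h: "w = (\<Sum>i\<in>{1..Suc n}. h i * F i)" "\<And>i. i \<in> {1..Suc n} \<Longrightarrow> h i \<in> alg"
        "\<And>i. i \<in> {1..Suc n} \<Longrightarrow> h i \<in> hom (a - b i)"
      by (rule gen_Int_homE[where f = w and a = a, OF graded_ideal_alg F]) (use w in auto)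
    define x where "x = (\<Sum>i\<in>{1..n}. h i * F i)"
    have w_eq: "w = x + h (Suc n) * ?f"
      using h(1) by (simp add: x_def)
    have "x \<in> gen alg F n"
      unfolding x_def using h(2) by (intro genI) auto
    moreover have hh: "h (Suc n) \<in> hom ?a'"
      using h(3)[of "Suc n"] by simp
    moreover have "x \<in> hom a"
      using mem_hom_diff[of w a "h (Suc n) * ?f"] hom_mult_f[OF hh] w w_eq by simp
    ultimately have x: "x \<in> ?U"
      by blast
    obtain c where c: "h (Suc n) - (\<Sum>z\<in>Z. Poly_Mapping.single 0 (c z) * z) \<in> ?U'" (is "?d \<in> _")
      using Z_span[OF hh] by blast
    have "?f * ?d \<in> gen alg F n"
      using graded_ideal_mult[OF ideal _ f(2)] c by blast
    then have "?d * ?f \<in> ?U"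
      using hom_mult_f[of ?d] c by (simp add: mult.commute)
    then have "x + ?d * ?f \<in> ?U"
      by (rule pm.subspace_add[OF sub(1) x])
    moreover have "w - (\<Sum>z\<in>Z. Poly_Mapping.single 0 (c z) * (z * ?f)) = x + ?d * ?f"
      unfolding scale_f w_eq by (simp add: left_diff_distrib)
    ultimately have "\<exists>c. w - (\<Sum>z\<in>Z. Poly_Mapping.single 0 (c z) * (z * ?f)) \<in> pm.span B"
      unfolding span_B by metis
    then show "w \<in> pm.span (B \<union> (\<lambda>z. z * ?f) ` Z)"
      using pm.mem_span_Un_image_iff[OF Z(1), of w B "\<lambda>z. z * ?f"] by simp
  qed
  moreover have "B \<union> (\<lambda>z. z * ?f) ` Z \<subseteq> ?W"
  proof -
    have "z * ?f \<in> ?W" if "z \<in> Z" for z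
      using gen_Suc_I[OF graded_ideal_alg, of z F n] hom_mult_f[of z] Z(2) hom_subset_alg that by blast
    then show ?thesis
      using B(1) gen_mono_Suc[OF graded_ideal_alg, of F n] by blast
  qed
  moreover have "card (B \<union> (\<lambda>z. z * ?f) ` Z) = pm.dim ?U + card Z"
    using indep B(4) finB Z(1) by (subst card_Un_disjoint) (auto simp: card_image)
  ultimately have "pm.dim ?W = pm.dim ?U + card Z"
    using indep by (intro pm.dim_unique[of "B \<union> (\<lambda>z. z * ?f) ` Z"]) auto
  then show ?thesis
    using Z(3) by simp
qed

text \<open>The left-hand side is the dimension of the quotient in degree \<open>a\<close>. In the
  induction, the subsets containing \<open>Suc n\<close> reproduce the formula for \<open>n\<close>
  at degree \<open>a - b (Suc n)\<close> with the opposite sign, which is what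
  \<open>dim_gen_Suc\<close> asks for.\<close>

lemma codim_gen_regular:
  fixes F :: "nat \<Rightarrow> 'g \<Rightarrow>\<^sub>0 'k::field"
  assumes "\<And>i. i \<in> {1..n} \<Longrightarrow> F i \<in> hom (b i)" and "regular_seq F n"
  shows "int (pm.dim (hom a :: ('g \<Rightarrow>\<^sub>0 'k) set)) - int (pm.dim (gen alg F n \<inter> hom a))
    = (\<Sum>I\<in>Pow {1..n}. (- 1) ^ card I * int (pm.dim (hom (a - sum b I) :: ('g \<Rightarrow>\<^sub>0 'k) set)))"
  using assms
proof (induction n arbitrary: a)
  case 0
  have "gen alg F 0 \<inter> hom a \<subseteq> pm.span {}"
    by (auto simp: gen_def)
  from pm.dim_le_card[OF this] have "pm.dim (gen alg F 0 \<inter> hom a) = 0"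
    by simp
  then show ?case
    by simp
next
  case (Suc n)
  let ?D = "\<lambda>a. int (pm.dim (hom a :: ('g \<Rightarrow>\<^sub>0 'k) set))"
  let ?g = "\<lambda>I. (- 1) ^ card I * ?D (a - sum b I)"
  have IH: "?D a - int (pm.dim (gen alg F n \<inter> hom a))
      = (\<Sum>I\<in>Pow {1..n}. (- 1) ^ card I * ?D (a - sum b I))" for a
    using Suc.prems by (intro Suc.IH) (auto simp: regular_seq_def)
  have ins: "inj_on (insert (Suc n)) (Pow {1..n})"
  proof (rule inj_onI)
    fix I I' assume "I \<in> Pow {1..n}" "I' \<in> Pow {1..n}" "insert (Suc n) I = insert (Suc n) I'"
    moreover from this have "Suc n \<notin> I" "Suc n \<notin> I'"
      by auto
    ultimately show "I = I'"
      by (simp add: insert_ident)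
  qed
  have "{1..Suc n} = insert (Suc n) {1..n}"
    by auto
  then have Pow_eq: "Pow {1..Suc n} = Pow {1..n} \<union> insert (Suc n) ` Pow {1..n}"
    by (simp only: Pow_insert)
  have "(\<Sum>I\<in>Pow {1..Suc n}. ?g I) = (\<Sum>I\<in>Pow {1..n}. ?g I) + (\<Sum>I\<in>insert (Suc n) ` Pow {1..n}. ?g I)"
  proof -
    have "Suc n \<notin> I" if "I \<in> Pow {1..n}" for I
      using that by auto
    then have "Pow {1..n} \<inter> insert (Suc n) ` Pow {1..n} = {}"
      by blast
    then show ?thesis
      unfolding Pow_eq by (intro sum.union_disjoint) simp_all
  qed
  also have "(\<Sum>I\<in>insert (Suc n) ` Pow {1..n}. ?g I) = (\<Sum>I\<in>Pow {1..n}. ?g (insert (Suc n) I))"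
    by (subst sum.reindex[OF ins]) (simp only: o_def)
  also have "\<dots> = (\<Sum>I\<in>Pow {1..n}. - ((- 1) ^ card I * ?D ((a - b (Suc n)) - sum b I)))"
  proof (rule sum.cong)
    fix I assume "I \<in> Pow {1..n}"
    then have "finite I" "Suc n \<notin> I"
      by (auto intro: finite_subset)
    then show "?g (insert (Suc n) I) = - ((- 1) ^ card I * ?D ((a - b (Suc n)) - sum b I))"
      by (simp add: diff_diff_eq)
  qed simp
  also have "\<dots> = - (\<Sum>I\<in>Pow {1..n}. (- 1) ^ card I * ?D ((a - b (Suc n)) - sum b I))"
    by (rule sum_negf)
  finally have "(\<Sum>I\<in>Pow {1..Suc n}. ?g I)
      = ?D a - int (pm.dim (gen alg F n \<inter> hom a))
        - (?D (a - b (Suc n)) - int (pm.dim (gen alg F n \<inter> hom (a - b (Suc n)))))"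
    unfolding IH by simp
  then show ?case
    using dim_gen_Suc[OF Suc.prems, of a] by linarith
qed

section \<open>Syzygies and the uniqueness of the degrees of generators\<close>

text \<open>Regularity puts the last coefficient into the ideal of the preceding elements. Expanding
  it there turns the relation into one among those elements, to which the induction hypothesis
  applies; the corrections \<open>g j * F (Suc n)\<close> lie in the larger ideal anyway.\<close>

lemma syzygy_in_gen:
  fixes F :: "nat \<Rightarrow> 'g \<Rightarrow>\<^sub>0 'k::field"
  assumes "\<And>i. i \<in> {1..n} \<Longrightarrow> F i \<in> hom (b i)" and "regular_seq F n"
    and "\<And>i. i \<in> {1..n} \<Longrightarrow> h i \<in> alg" and "(\<Sum>i\<in>{1..n}. h i * F i) = 0" and "i \<in> {1..n}"
  shows "h i \<in> gen alg F n"
  using assms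
proof (induction n arbitrary: h i)
  case (Suc n)
  let ?f = "F (Suc n)"
  have ideal: "graded_ideal (gen alg F n)" "graded_ideal (gen alg F (Suc n))"
    using Suc.prems(1) by (auto intro!: graded_ideal_gen[OF graded_ideal_alg, of _ F b])
  have "h (Suc n) * ?f = - (\<Sum>i\<in>{1..n}. h i * F i)"
    using Suc.prems(4) by (simp add: eq_neg_iff_add_eq_0 add.commute)
  also have "\<dots> \<in> gen alg F n"
    using Suc.prems(3) by (intro graded_ideal_uminus[OF ideal(1)] genI) auto
  finally have last: "h (Suc n) \<in> gen alg F n"
    using Suc.prems(2,3) by (auto simp: regular_seq_def)
  obtain g where g: "h (Suc n) = (\<Sum>i\<in>{1..n}. g i * F i)" "\<And>i. i \<in> {1..n} \<Longrightarrow> g i \<in> alg"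
    using that by (rule genE[OF last])
  have f: "?f \<in> alg"
    using Suc.prems(1)[of "Suc n"] hom_subset_alg by auto
  have mono: "gen alg F n \<subseteq> gen alg F (Suc n)"
    by (rule gen_mono_Suc[OF graded_ideal_alg])
  have "(\<Sum>j\<in>{1..n}. (h j + g j * ?f) * F j) = (\<Sum>i\<in>{1..n}. h i * F i) + h (Suc n) * ?f"
    unfolding g(1) sum_distrib_right distrib_right sum.distrib by (simp add: mult_ac)
  also have "\<dots> = 0"
    using Suc.prems(4) by simp
  finally have sum0: "(\<Sum>j\<in>{1..n}. (h j + g j * ?f) * F j) = 0" .
  show ?case
  proof (cases "i = Suc n")
    case True
    then show ?thesis
      using last mono by blast
  next
    case False
    then have i: "i \<in> {1..n}"
      using Suc.prems(5) by auto
    have "h i + g i * ?f \<in> gen alg F n"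
    proof (rule Suc.IH[of "\<lambda>i. h i + g i * ?f" i, OF _ _ _ sum0 i])
      show "F j \<in> hom (b j)" if "j \<in> {1..n}" for j
        using that by (intro Suc.prems(1)) simp
      show "regular_seq F n"
        using Suc.prems(2) unfolding regular_seq_def by (metis less_Suc_eq)
      show "h j + g j * ?f \<in> alg" if "j \<in> {1..n}" for j
        using that by (intro alg_add alg_mult Suc.prems(3) g(2) f) simp_all
    qed
    then have "h i + g i * ?f \<in> gen alg F (Suc n)"
      using mono by blast
    moreover have "- (g i * ?f) \<in> gen alg F (Suc n)"
      using gen_Suc_I[OF graded_ideal_alg g(2)[OF i]] by (rule graded_ideal_uminus[OF ideal(2)])
    ultimately have "(h i + g i * ?f) + - (g i * ?f) \<in> gen alg F (Suc n)"
      using ideal(2) unfolding graded_ideal_def by blast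
    then show ?thesis
      by simp
  qed
qed simp

lemma gen_alg_subset:
  assumes "graded_ideal A" and "\<And>i. i \<in> {1..n} \<Longrightarrow> F i \<in> A"
  shows "gen alg F n \<subseteq> A"
proof
  fix f assume f: "f \<in> gen alg F n"
  obtain h where h: "f = (\<Sum>i\<in>{1..n}. h i * F i)" "\<And>i. i \<in> {1..n} \<Longrightarrow> h i \<in> alg"
    using that by (rule genE[OF f])
  show "f \<in> A"
    unfolding h(1) using assms h(2) by (intro graded_ideal_sum graded_ideal_mult)
qed

text \<open>m J depends only on the ideal J and not on its generators; this is one inclusion. A
  coefficient in m absorbs the coefficients of an expansion in \<open>G\<close>.\<close>

lemma gen_max_ideal_mono:
  fixes F G :: "nat \<Rightarrow> 'g \<Rightarrow>\<^sub>0 'k::field"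
  assumes G: "\<And>i. i \<in> {1..m} \<Longrightarrow> G i \<in> hom (c i)" and F: "\<And>i. i \<in> {1..n} \<Longrightarrow> F i \<in> gen alg G m"
  shows "gen max_ideal F n \<subseteq> gen max_ideal G m"
proof
  have *: "h * f \<in> gen max_ideal G m" if h: "h \<in> max_ideal" and f: "f \<in> gen alg G m" for h f
  proof -
    obtain k where k: "f = (\<Sum>i\<in>{1..m}. k i * G i)" "\<forall>i\<in>{1..m}. k i \<in> alg"
      using f by (auto simp: gen_def)
    have "h * f = (\<Sum>i\<in>{1..m}. (k i * h) * G i)"
      unfolding k(1) sum_distrib_left by (simp add: mult_ac)
    also have "\<dots> \<in> gen max_ideal G m"
      using k(2) h by (intro genI graded_ideal_mult[OF graded_ideal_max_ideal]) simp_all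
    finally show ?thesis .
  qed
  fix f assume f: "f \<in> gen max_ideal F n"
  obtain h where h: "f = (\<Sum>i\<in>{1..n}. h i * F i)" "\<And>i. i \<in> {1..n} \<Longrightarrow> h i \<in> max_ideal"
    using that by (rule genE[OF f])
  show "f \<in> gen max_ideal G m"
    unfolding h(1)
    using h(2) F by (intro graded_ideal_sum[OF graded_ideal_gen[OF graded_ideal_max_ideal G]] *)
qed

text \<open>A nonzero constant term forces degree zero, where \<open>E_Int_H\<close> leaves only
  constants; \<open>f\<close> would then be a nonzero constant and hence invertible.\<close>

lemma hom_subset_max_ideal:
  assumes "f \<in> hom a" and "\<And>h. h \<in> alg \<Longrightarrow> h * f \<noteq> 1"
  shows "f \<in> max_ideal"
proof (rule ccontr)
  assume "f \<notin> max_ideal"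
  then have nz: "Poly_Mapping.lookup f 0 \<noteq> 0"
    using assms(1) hom_subset_alg by (auto simp: max_ideal_def)
  then have "0 - a \<in> H"
    using assms(1) in_keys_iff[of 0 f] unfolding hom_def by blast
  then have "f \<in> hom 0"
    using assms(1) by (simp only: hom_eqI)
  then have "Poly_Mapping.keys f \<subseteq> {0}"
    using E_Int_H by (auto simp: hom_def)
  then have "f = Poly_Mapping.single 0 (Poly_Mapping.lookup f 0)"
    by (intro poly_mapping_eqI) (auto simp: lookup_single when_def in_keys_iff)
  then have "Poly_Mapping.single 0 (1 / Poly_Mapping.lookup f 0) * f = 1"
    using nz by (metis mult_single add_0 nonzero_eq_divide_eq single_one)
  then show False
    using assms(2) alg_const by blast
qed

lemma generator_in_gen:
  assumes "i \<in> {1..n}"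
  shows "F i \<in> gen alg F n"
proof -
  have "(\<Sum>j\<in>{1..n}. (if j = i then 1 else 0) * F j) \<in> gen alg F n"
    by (rule genI) (simp add: alg_one, simp add: alg_def)
  also have "(\<Sum>j\<in>{1..n}. (if j = i then 1 else 0) * F j) = (\<Sum>j\<in>{1..n}. if j = i then F j else 0)"
    by (rule sum.cong) simp_all
  finally show ?thesis
    using assms by simp
qed

text \<open>A graded Nakayama count in J/mJ, with \<open>?U\<close> the degree \<open>d\<close>
  piece of m J: the \<open>F i\<close> of degree \<open>d\<close> are independent by the syzygy
  lemma and are combinations of the \<open>G j\<close> of degree \<open>d\<close>.\<close>

lemma card_degrees_le:
  fixes F G :: "nat \<Rightarrow> 'g \<Rightarrow>\<^sub>0 'k::field"
  assumes F: "\<And>i. i \<in> {1..n} \<Longrightarrow> F i \<in> hom (b i)" and G: "\<And>i. i \<in> {1..m} \<Longrightarrow> G i \<in> hom (c i)"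
    and reg: "regular_seq F n" and proper: "1 \<notin> gen alg F n" and eq: "gen alg F n = gen alg G m"
  shows "card {i \<in> {1..n}. b i - d \<in> H} \<le> card {j \<in> {1..m}. c j - d \<in> H}"
proof -
  let ?A = "{i \<in> {1..n}. b i - d \<in> H}" and ?C = "{j \<in> {1..m}. c j - d \<in> H}"
  let ?U = "gen max_ideal G m \<inter> hom d"
  have ideal_F: "graded_ideal (gen alg F n)"
    using F by (rule graded_ideal_gen[OF graded_ideal_alg])
  note F_in = generator_in_gen[of _ n F] and G_in = generator_in_gen[of _ m G, folded eq]
  \<comment> \<open>As the ideal is proper, its generators are nonunits, so J is contained in
    m.\<close>
  have "h * F i \<noteq> 1" if "i \<in> {1..n}" "h \<in> alg" for i h
    using graded_ideal_mult[OF ideal_F F_in[OF that(1)] that(2)] proper by auto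
  then have "F i \<in> max_ideal" if "i \<in> {1..n}" for i
    using hom_subset_max_ideal[OF F[OF that]] that by blast
  then have subset_max: "gen alg F n \<subseteq> max_ideal"
    by (rule gen_alg_subset[OF graded_ideal_max_ideal])
  have sub: "pm.subspace ?U"
    using G by (intro pm.subspace_inter subspace_hom subspace_graded_ideal graded_ideal_gen[OF graded_ideal_max_ideal])
  obtain B where B: "B \<subseteq> ?U" "pm.independent B" "?U \<subseteq> pm.span B" "card B = pm.dim ?U"
    by (rule pm.basis_exists)
  have "B \<subseteq> pm.span ((\<lambda>x. Poly_Mapping.single x 1) ` {x \<in> E. x - d \<in> H})"
    using B(1) hom_subset_span by blast
  then have finB: "finite B"
    using pm.independent_span_bound[OF _ B(2)] finite_degree[of d] by blast
  have span_B: "pm.span B = ?U"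
    using B(1,3) pm.span_minimal[OF B(1) sub] by blast
  have indep: "inj_on F ?A \<and> F ` ?A \<inter> B = {} \<and> pm.independent (B \<union> F ` ?A)"
  proof (intro pm.independent_Un_image[OF _ B(2)] allI impI ballI)
    fix l i0
    assume "(\<Sum>i\<in>?A. Poly_Mapping.single 0 (l i) * F i) \<in> pm.span B" and i0: "i0 \<in> ?A"
    \<comment> \<open>Rewriting m J in terms of \<open>F\<close> puts both sides of the relation in
      the same generators; their difference is the syzygy \<open>k\<close>.\<close>
    then have "(\<Sum>i\<in>?A. Poly_Mapping.single 0 (l i) * F i) \<in> gen max_ideal F n"
      unfolding span_B using gen_max_ideal_mono[where F = G and G = F and n = m and m = n, OF F G_in] by blast
    then obtain h where h: "(\<Sum>i\<in>?A. Poly_Mapping.single 0 (l i) * F i) = (\<Sum>i\<in>{1..n}. h i * F i)"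
        "\<forall>i\<in>{1..n}. h i \<in> max_ideal"
      by (auto simp: gen_def)
    define k where "k i = (if i \<in> ?A then Poly_Mapping.single 0 (l i) else 0) - h i" for i
    have "(\<Sum>i\<in>{1..n}. (if i \<in> ?A then Poly_Mapping.single 0 (l i) else 0) * F i)
        = (\<Sum>i\<in>?A. Poly_Mapping.single 0 (l i) * F i)"
      by (intro sum.mono_neutral_cong_right) auto
    then have sum0: "(\<Sum>i\<in>{1..n}. k i * F i) = 0"
      unfolding k_def left_diff_distrib sum_subtractf h(1) by simp
    have "k i \<in> alg" if "i \<in> {1..n}" for i
    proof -
      have "- h i \<in> alg"
        using h(2) that by (intro alg_uminus) (auto simp: max_ideal_def)
      moreover have "(if i \<in> ?A then Poly_Mapping.single 0 (l i) else 0) \<in> alg"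
        by (simp add: alg_const) (simp add: alg_def)
      ultimately show ?thesis
        using alg_add unfolding k_def diff_conv_add_uminus by blast
    qed
    \<comment> \<open>The coefficient \<open>k i0\<close> lies in J and so in m, as does
      \<open>h i0\<close>; hence the constant \<open>l i0\<close> is in m and vanishes.\<close>
    then have "k i0 \<in> gen alg F n"
      using i0 by (intro syzygy_in_gen[OF F reg _ sum0]) auto
    then have "k i0 \<in> max_ideal" "h i0 \<in> max_ideal"
      using subset_max h(2) i0 by auto
    then show "l i0 = 0"
      using i0 by (simp add: max_ideal_def k_def lookup_minus)
  qed simp
  have "F i \<in> pm.span (B \<union> G ` ?C)" if i: "i \<in> ?A" for i
  proof -
    have Fi: "F i \<in> hom d"
      using F[of i] i hom_eqI[of "b i" d] by auto
    obtain h where h: "F i = (\<Sum>j\<in>{1..m}. h j * G j)" "\<And>j. j \<in> {1..m} \<Longrightarrow> h j \<in> alg"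
        "\<And>j. j \<in> {1..m} \<Longrightarrow> h j \<in> hom (d - c j)"
      by (rule gen_Int_homE[where f = "F i" and a = d, OF graded_ideal_alg G])
        (use F_in[of i] i eq Fi in auto)
    \<comment> \<open>Constant terms are removed where \<open>G j\<close> has degree
      \<open>d\<close>. For any other \<open>j\<close> the coefficient \<open>h j\<close> has
      nonzero degree and no constant term, so every \<open>k j\<close> lies in m.\<close>
    define k where "k j = h j - (if j \<in> ?C then Poly_Mapping.single 0 (Poly_Mapping.lookup (h j) 0) else 0)" for j
    have k_max: "k j \<in> max_ideal" if j: "j \<in> {1..m}" for j
    proof -
      have "Poly_Mapping.lookup (h j) 0 = 0" if nC: "j \<notin> ?C"
      proof (rule ccontr)
        assume "Poly_Mapping.lookup (h j) 0 \<noteq> 0"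
        then have "0 - (d - c j) \<in> H"
          using h(3)[OF j] in_keys_iff[of 0 "h j"] unfolding hom_def by blast
        then show False
          using nC j by simp
      qed
      moreover have "- (if j \<in> ?C then Poly_Mapping.single 0 (Poly_Mapping.lookup (h j) 0) else 0) \<in> alg"
        by (intro alg_uminus) (simp add: alg_const, simp add: alg_def)
      then have "k j \<in> alg"
        using alg_add[OF h(2)[OF j]] unfolding k_def diff_conv_add_uminus by blast
      ultimately show ?thesis
        by (auto simp: max_ideal_def k_def lookup_minus)
    qed
    have "(\<Sum>j\<in>{1..m}. (if j \<in> ?C then Poly_Mapping.single 0 (Poly_Mapping.lookup (h j) 0) else 0) * G j)
        = (\<Sum>j\<in>?C. Poly_Mapping.single 0 (Poly_Mapping.lookup (h j) 0) * G j)"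
      by (intro sum.mono_neutral_cong_right) auto
    then have k_sum: "(\<Sum>j\<in>{1..m}. k j * G j)
        = F i - (\<Sum>j\<in>?C. Poly_Mapping.single 0 (Poly_Mapping.lookup (h j) 0) * G j)"
      unfolding k_def left_diff_distrib sum_subtractf h(1) by simp
    have "G j \<in> hom d" if "j \<in> ?C" for j
      using G[of j] that hom_eqI[of "c j" d] by auto
    then have "F i - (\<Sum>j\<in>?C. Poly_Mapping.single 0 (Poly_Mapping.lookup (h j) 0) * G j) \<in> hom d"
      by (intro mem_hom_diff[OF Fi] pm.subspace_sum[OF subspace_hom] pm.subspace_scale[OF subspace_hom])
    moreover have "(\<Sum>j\<in>{1..m}. k j * G j) \<in> gen max_ideal G m"
      using k_max by (rule genI)
    ultimately have "\<exists>l. F i - (\<Sum>j\<in>?C. Poly_Mapping.single 0 (l j) * G j) \<in> pm.span B"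
      unfolding span_B k_sum
      by (intro exI[of _ "\<lambda>j. Poly_Mapping.lookup (h j) 0"]) (rule IntI)
    then show ?thesis
      using pm.mem_span_Un_image_iff[of ?C "F i" B G] by simp
  qed
  \<comment> \<open>The basis \<open>B\<close> of \<open>?U\<close> occurs on both sides of the
    comparison of cardinalities and cancels.\<close>
  then have "B \<union> F ` ?A \<subseteq> pm.span (B \<union> G ` ?C)"
    using pm.span_superset[of "B \<union> G ` ?C"] by blast
  then have "card (B \<union> F ` ?A) \<le> card (B \<union> G ` ?C)"
    using pm.independent_span_bound[of "B \<union> G ` ?C" "B \<union> F ` ?A"] finB indep by simp
  also have "\<dots> \<le> card B + card ?C"
    by (rule order_trans[OF card_Un_le]) (simp add: card_image_le)
  also have "card (B \<union> F ` ?A) = card B + card ?A"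
    using indep finB by (subst card_Un_disjoint) (auto simp: card_image)
  finally show ?thesis
    by simp
qed

text \<open>\<open>card_degrees_le\<close> in all degrees is an inclusion between the multisets of
  degree classes; both have \<open>n\<close> members, so they are equal.\<close>

lemma degrees_permuted:
  fixes F G :: "nat \<Rightarrow> 'g \<Rightarrow>\<^sub>0 'k::field"
  assumes F: "\<And>i. i \<in> {1..n} \<Longrightarrow> F i \<in> hom (b i)" and G: "\<And>i. i \<in> {1..n} \<Longrightarrow> G i \<in> hom (c i)"
    and reg: "regular_seq F n" and proper: "1 \<notin> gen alg F n" and eq: "gen alg F n = gen alg G n"
  obtains p where "p permutes {1..n}" and "\<And>i. i \<in> {1..n} \<Longrightarrow> b i - c (p i) \<in> H"
proof -
  \<comment> \<open>Cosets turn congruence of degrees modulo \<open>H\<close> into equality, as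
    needed for multisets.\<close>
  define cl where "cl x = {y. y - x \<in> H}" for x
  have cl_eq: "cl x = cl y \<longleftrightarrow> x - y \<in> H" for x y
  proof
    assume "cl x = cl y"
    moreover have "x \<in> cl x"
      by (simp add: cl_def zero_H)
    ultimately show "x - y \<in> H"
      by (simp add: cl_def)
  next
    assume xy: "x - y \<in> H"
    have "z - x \<in> H \<longleftrightarrow> z - y \<in> H" for z
      using diff_H_iff[of "z - y" "z - x"] xy by (simp add: algebra_simps)
    then show "cl x = cl y"
      by (simp add: cl_def)
  qed
  let ?M = "\<lambda>b. image_mset (\<lambda>i. cl (b i)) (mset_set {1..n})"
  have "count (?M b) y \<le> count (?M c) y" for y
  proof (cases "\<exists>d. y = cl d")
    case True
    then obtain d where "y = cl d"
      by blast
    then show ?thesis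
      using card_degrees_le[OF F G reg proper eq, of d]
      by (simp add: count_image_mset_eq_card_vimage cl_eq)
  next
    \<comment> \<open>A value that is not a coset has multiplicity 0.\<close>
    case False
    then have "{i \<in> {1..n}. cl (b i) = y} = {}"
      by blast
    then show ?thesis
      by (simp only: count_image_mset_eq_card_vimage finite_atLeastAtMost card.empty)
  qed
  then have "?M b \<subseteq># ?M c"
    by (rule mset_subset_eqI)
  moreover have "size (?M b) = size (?M c)"
    by simp
  ultimately have "?M b = ?M c"
    by (metis mset_subset_size subset_mset.le_imp_less_or_eq nat_neq_iff)
  then show thesis
    using that image_mset_eq_implies_permutes[of "{1..n}" "\<lambda>i. cl (b i)" "\<lambda>i. cl (c i)"] cl_eq
    by (metis finite_atLeastAtMost)
qed

text \<open>The alternating sum depends on the degrees only up to order and modulo \<open>H\<close>,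
  so those of the regular sequence may be replaced by those of \<open>G\<close>.\<close>

lemma codim_gen_complete_intersection:
  fixes F G :: "nat \<Rightarrow> 'g \<Rightarrow>\<^sub>0 'k::field"
  assumes F: "\<And>i. i \<in> {1..n} \<Longrightarrow> F i \<in> hom (b i)" and G: "\<And>i. i \<in> {1..n} \<Longrightarrow> G i \<in> hom (c i)"
    and reg: "regular_seq F n" and proper: "1 \<notin> gen alg F n" and eq: "gen alg F n = gen alg G n"
  shows "int (pm.dim (hom a :: ('g \<Rightarrow>\<^sub>0 'k) set)) - int (pm.dim (gen alg G n \<inter> hom a))
    = (\<Sum>I\<in>Pow {1..n}. (- 1) ^ card I * int (card {x \<in> E. x - (a - sum c I) \<in> H}))"
proof -
  obtain p where p: "p permutes {1..n}" "\<And>i. i \<in> {1..n} \<Longrightarrow> b i - c (p i) \<in> H"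
    using degrees_permuted[OF F G reg proper eq] by metis
  have inj: "inj p"
    by (rule permutes_inj[OF p(1)])
  let ?D = "\<lambda>a. int (card {x \<in> E. x - a \<in> H})"
  have "(\<Sum>I\<in>Pow {1..n}. (- 1) ^ card I * ?D (a - sum b I))
      = (\<Sum>I\<in>Pow {1..n}. (- 1) ^ card (p ` I) * ?D (a - sum c (p ` I)))"
  proof (rule sum.cong)
    fix I assume I: "I \<in> Pow {1..n}"
    have "sum c (p ` I) = (\<Sum>i\<in>I. c (p i))"
      using inj by (simp add: sum.reindex inj_on_def inj_def)
    moreover have "(\<Sum>i\<in>I. b i - c (p i)) \<in> H"
      using I p(2) by (induction I rule: infinite_finite_induct) (auto simp: zero_H add_H)
    ultimately have "(a - sum c (p ` I)) - (a - sum b I) \<in> H"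
      by (simp add: sum_subtractf)
    \<comment> \<open>The two counts agree because both are the dimension of the same graded
      piece.\<close>
    then have "(hom (a - sum c (p ` I)) :: ('g \<Rightarrow>\<^sub>0 'k) set) = hom (a - sum b I)"
      by (rule hom_eqI)
    then have "?D (a - sum c (p ` I)) = ?D (a - sum b I)"
      by (simp flip: dim_hom[where 'k = 'k])
    then show "(- 1) ^ card I * ?D (a - sum b I) = (- 1) ^ card (p ` I) * ?D (a - sum c (p ` I))"
      using card_image[OF inj_on_subset[OF inj subset_UNIV], of I] by simp
  qed simp
  also have "\<dots> = (\<Sum>I\<in>(`) p ` Pow {1..n}. (- 1) ^ card I * ?D (a - sum c I))"
    using inj by (subst sum.reindex) (auto simp: inj_on_def inj_image_eq_iff)
  also have "(`) p ` Pow {1..n} = Pow {1..n}"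
    using image_Pow_surj[of p "{1..n}" "{1..n}"] permutes_image[OF p(1)] by blast
  finally show ?thesis
    using codim_gen_regular[OF F reg, of a] unfolding eq dim_hom by simp
qed

end

section \<open>Simplicial complete fans\<close>

text \<open>Points of the cone have nonnegative coordinates in \<open>G\<close>, and those of the
  ray have only the coordinate of \<open>g\<close>. A convex combination with positive weights of
  two nonnegative numbers vanishes only if both do.\<close>

lemma face_of_independent_cone:
  fixes g :: "'a::real_inner"
  assumes G: "independent G" and fin: "finite G" and g: "g \<in> G"
  shows "convex_cone hull {g} face_of convex_cone hull G"
proof -
  let ?\<phi> = "\<lambda>h x. real_vector.representation G x h"
  let ?K = "{x \<in> span G. \<forall>h\<in>G. 0 \<le> ?\<phi> h x}"
  have "convex_cone ?K"
    unfolding convex_cone_iff using G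
    by (auto simp: real_vector.representation_add real_vector.representation_scale
        real_vector.representation_zero span_zero span_add span_scale)
  moreover have "G \<subseteq> ?K"
    using G by (auto simp: span_base real_vector.representation_basis)
  ultimately have K: "convex_cone hull G \<subseteq> ?K"
    by (rule hull_minimal[rotated])
  have line: "x \<in> convex_cone hull {g}" if x: "x \<in> ?K" and "\<forall>h\<in>G - {g}. ?\<phi> h x = 0" for x
  proof -
    have "x = (\<Sum>h\<in>G. ?\<phi> h x *\<^sub>R h)"
      using real_vector.sum_representation_eq[OF G _ fin subset_refl, of x] x by simp
    also have "\<dots> = ?\<phi> g x *\<^sub>R g"
      using that(2) fin g by (subst sum.remove[of G g]) (auto intro!: sum.neutral)
    finally have "x = ?\<phi> g x *\<^sub>R g" .
    moreover have "?\<phi> g x *\<^sub>R g \<in> convex_cone hull {g}"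
      using x g by (intro convex_cone_hull_mul hull_inc) auto
    ultimately show ?thesis
      by metis
  qed
  have off: "?\<phi> h x = 0" if "x \<in> convex_cone hull {g}" "h \<in> G - {g}" for x h
  proof -
    have "convex_cone {x \<in> span G. ?\<phi> h x = 0}"
      unfolding convex_cone_iff using G
      by (auto simp: real_vector.representation_add real_vector.representation_scale
          real_vector.representation_zero span_zero span_add span_scale)
    moreover have "{g} \<subseteq> {x \<in> span G. ?\<phi> h x = 0}"
      using G g that(2) by (auto simp: span_base real_vector.representation_basis)
    ultimately have "convex_cone hull {g} \<subseteq> {x \<in> span G. ?\<phi> h x = 0}"
      by (rule hull_minimal[rotated])
    then show ?thesis
      using that(1) by blast
  qed
  show ?thesis
    unfolding face_of_def
  proof (intro conjI ballI impI)
    show "convex_cone hull {g} \<subseteq> convex_cone hull G"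
      using g by (intro hull_mono) simp
    show "convex (convex_cone hull {g})"
      by (rule convex_convex_cone_hull)
  next
    fix x y z
    assume "x \<in> convex_cone hull G" "y \<in> convex_cone hull G"
      and z: "z \<in> convex_cone hull {g}" and "z \<in> open_segment x y"
    then obtain u where xy: "x \<in> ?K" "y \<in> ?K" and u: "0 < u" "u < 1" "z = (1 - u) *\<^sub>R x + u *\<^sub>R y"
      using K by (auto simp: in_segment)
    have "?\<phi> h x = 0 \<and> ?\<phi> h y = 0" if h: "h \<in> G - {g}" for h
    proof -
      have "(1 - u) * ?\<phi> h x + u * ?\<phi> h y = ?\<phi> h z"
        using xy G u(3)
        by (simp add: real_vector.representation_add real_vector.representation_scale span_scale)
      also have "\<dots> = 0"
        by (rule off[OF z h])
      finally have "(1 - u) * ?\<phi> h x + u * ?\<phi> h y = 0" .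
      moreover have "0 \<le> (1 - u) * ?\<phi> h x" "0 \<le> u * ?\<phi> h y"
        using xy h u by auto
      ultimately have "(1 - u) * ?\<phi> h x = 0" "u * ?\<phi> h y = 0"
        by linarith+
      then show ?thesis
        using u by auto
    qed
    then show "x \<in> convex_cone hull {g}" "y \<in> convex_cone hull {g}"
      using line xy by auto
  qed
qed

lemma ray_eq_scale: "ray v j = {c *\<^sub>R v j |c. 0 \<le> c}"
proof -
  have "convex_cone {c *\<^sub>R v j |c. 0 \<le> c}"
    unfolding convex_cone_iff
  proof (intro conjI ballI allI impI)
    show "0 \<in> {c *\<^sub>R v j |c. 0 \<le> c}"
      by (auto intro!: exI[of _ 0])
    show "x + y \<in> {c *\<^sub>R v j |c. 0 \<le> c}"
      if "x \<in> {c *\<^sub>R v j |c. 0 \<le> c}" "y \<in> {c *\<^sub>R v j |c. 0 \<le> c}" for x y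
      using that by (auto simp flip: scaleR_add_left intro: add_nonneg_nonneg)
    show "a *\<^sub>R x \<in> {c *\<^sub>R v j |c. 0 \<le> c}" if "x \<in> {c *\<^sub>R v j |c. 0 \<le> c}" "0 \<le> a" for x a
      using that by auto
  qed
  moreover have "{v j} \<subseteq> {c *\<^sub>R v j |c. 0 \<le> c}"
    by (auto intro!: exI[of _ 1])
  ultimately have "ray v j \<subseteq> {c *\<^sub>R v j |c. 0 \<le> c}"
    unfolding ray_def by (rule hull_minimal[rotated])
  moreover have "c *\<^sub>R v j \<in> ray v j" if "0 \<le> c" for c
    unfolding ray_def using that by (intro convex_cone_hull_mul hull_inc) auto
  ultimately show ?thesis
    by blast
qed

locale complete_simplicial_fan =
  fixes N :: "'a::real_inner set" and n :: nat and \<Sigma> :: "'a set set" and r :: nat and v :: "nat \<Rightarrow> 'a"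
  assumes lat: "is_lattice N n" and fan: "is_fan N \<Sigma>" and complete: "complete_fan \<Sigma>"
    and simplicial: "simplicial_fan \<Sigma>" and rays: "primitive_ray_generators N \<Sigma> r v"
begin

text \<open>Completeness puts \<open>u\<close> into a cone with independent generators. Each
  generator spans a one-dimensional face, which is a ray of the fan, so the generator is a
  nonnegative multiple of some \<open>v j\<close>.\<close>

lemma nonneg_combination_of_rays:
  "\<exists>c. (\<forall>j. 0 \<le> c j) \<and> u = (\<Sum>j\<in>{1..r}. c j *\<^sub>R v j)"
proof -
  define P where "P = {\<Sum>j\<in>{1..r}. c j *\<^sub>R v j |c. \<forall>j. 0 \<le> c j}"
  have PI: "x \<in> P" if "x = (\<Sum>j\<in>{1..r}. c j *\<^sub>R v j)" "\<And>j. 0 \<le> c j" for x c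
    unfolding P_def using that by blast
  have cone: "convex_cone P"
    unfolding convex_cone_iff
  proof (intro conjI ballI allI impI)
    show "0 \<in> P"
      by (rule PI[of _ "\<lambda>_. 0"]) auto
  next
    fix x y assume "x \<in> P" "y \<in> P"
    then obtain c d where "x = (\<Sum>j\<in>{1..r}. c j *\<^sub>R v j)" "\<forall>j. 0 \<le> c j"
        "y = (\<Sum>j\<in>{1..r}. d j *\<^sub>R v j)" "\<forall>j. 0 \<le> d j"
      unfolding P_def by blast
    then show "x + y \<in> P"
      by (intro PI[of _ "\<lambda>j. c j + d j"]) (auto simp: scaleR_add_left sum.distrib)
  next
    fix x and a :: real assume "x \<in> P" "0 \<le> a"
    moreover from this obtain c where "x = (\<Sum>j\<in>{1..r}. c j *\<^sub>R v j)" "\<forall>j. 0 \<le> c j"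
      unfolding P_def by blast
    ultimately show "a *\<^sub>R x \<in> P"
      by (intro PI[of _ "\<lambda>j. a * c j"]) (auto simp: scaleR_sum_right)
  qed
  have "u \<in> \<Union>\<Sigma>"
    using complete by (simp add: complete_fan_def)
  then obtain \<sigma> where \<sigma>: "\<sigma> \<in> \<Sigma>" "u \<in> \<sigma>"
    by blast
  obtain G where G: "independent G" "\<sigma> = convex_cone hull G"
    using simplicial \<sigma>(1) unfolding simplicial_fan_def by blast
  \<comment> \<open>The lattice basis bounds the dimension, which makes \<open>G\<close>
    finite.\<close>
  obtain B :: "'a set" where "finite B" "span B = UNIV"
    using lat unfolding is_lattice_def by blast
  then have finG: "finite G"
    using real_vector.independent_span_bound[of B G] G(1) by simp
  have "g \<in> P" if g: "g \<in> G" for g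
  proof -
    let ?\<rho> = "convex_cone hull {g}"
    have "?\<rho> face_of \<sigma>"
      unfolding G(2) by (rule face_of_independent_cone[OF G(1) finG g])
    moreover have "?\<rho> \<noteq> {}"
      by (rule convex_cone_hull_nonempty)
    ultimately have "?\<rho> \<in> \<Sigma>"
      using fan \<sigma>(1) unfolding is_fan_def by blast
    moreover have "dim ?\<rho> = 1"
    proof (rule dim_unique)
      show "{g} \<subseteq> ?\<rho>"
        by (rule hull_subset)
      \<comment> \<open>The constant family with value \<open>g\<close> makes \<open>?\<rho>\<close>
        an instance of \<open>ray\<close>.\<close>
      show "?\<rho> \<subseteq> span {g}"
        using ray_eq_scale[of "\<lambda>_. g" 0] by (auto simp: ray_def intro: span_scale span_base)
      show "independent {g}"
        using G(1) g by (simp add: dependent_zero) (metis dependent_zero)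
    qed simp
    ultimately have "?\<rho> \<in> ray v ` {1..r}"
      using rays by (simp add: primitive_ray_generators_def bij_betw_def)
    then obtain j where j: "j \<in> {1..r}" "ray v j = ?\<rho>"
      by (metis imageE)
    then have "g \<in> ray v j"
      by (simp add: hull_inc)
    then obtain c where c: "g = c *\<^sub>R v j" "0 \<le> c"
      using ray_eq_scale by blast
    have "(\<Sum>i\<in>{1..r}. (if i = j then c else 0) *\<^sub>R v i) = (\<Sum>i\<in>{1..r}. if i = j then c *\<^sub>R v i else 0)"
      by (rule sum.cong) auto
    then show ?thesis
      using c j by (intro PI[of _ "\<lambda>i. if i = j then c else 0"]) auto
  qed
  then have "convex_cone hull G \<subseteq> P"
    using cone by (intro hull_minimal) auto
  then have "u \<in> P"
    using \<sigma>(2) G(2) by blast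
  then show ?thesis
    unfolding P_def by blast
qed

section \<open>Divisors of characters\<close>

definition effective :: "divisor set" where
  "effective = {D. Poly_Mapping.keys D \<subseteq> {1..r} \<and> (\<forall>j. 0 \<le> Poly_Mapping.lookup D j)}"

definition principal :: "divisor set" where
  "principal = char_divisor r v ` dual_lattice N"

lemma dual_lattice_add: "m \<in> dual_lattice N \<Longrightarrow> m' \<in> dual_lattice N \<Longrightarrow> m + m' \<in> dual_lattice N"
  by (auto simp: dual_lattice_def inner_add_left)

lemma dual_lattice_uminus: "m \<in> dual_lattice N \<Longrightarrow> - m \<in> dual_lattice N"
  by (auto simp: dual_lattice_def)

lemma zero_in_dual_lattice: "0 \<in> dual_lattice N"
  by (auto simp: dual_lattice_def)

lemma lookup_char_divisor:
  "Poly_Mapping.lookup (char_divisor r v m) j = (if j \<in> {1..r} then \<lfloor>m \<bullet> v j\<rfloor> else 0)"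
  by (auto simp: char_divisor_def lookup_sum lookup_single when_def)

lemma ray_generator_in_lattice: "j \<in> {1..r} \<Longrightarrow> v j \<in> N"
proof -
  assume "j \<in> {1..r}"
  then have "ray v j \<inter> N = {real k *\<^sub>R v j |k. True}"
    using rays by (simp add: primitive_ray_generators_def)
  moreover have "v j \<in> {real k *\<^sub>R v j |k. True}"
    by (auto intro!: exI[of _ 1])
  ultimately show "v j \<in> N"
    by blast
qed

text \<open>As \<open>v j\<close> lies in \<open>N\<close>, the pairing is an integer and the floor
  in \<open>char_divisor\<close> is exact.\<close>

lemma of_int_lookup_char_divisor:
  "m \<in> dual_lattice N \<Longrightarrow> j \<in> {1..r} \<Longrightarrow> of_int (Poly_Mapping.lookup (char_divisor r v m) j) = m \<bullet> v j"
  using ray_generator_in_lattice[of j] by (auto simp: lookup_char_divisor dual_lattice_def)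

text \<open>Comparing real values reduces identities between divisors of characters to linearity of
  the pairing.\<close>

lemma char_divisor_eqI:
  assumes "m \<in> dual_lattice N" and "Poly_Mapping.keys D \<subseteq> {1..r}"
    and "\<And>j. j \<in> {1..r} \<Longrightarrow> of_int (Poly_Mapping.lookup D j) = m \<bullet> v j"
  shows "D = char_divisor r v m"
proof (rule poly_mapping_eqI)
  fix j
  show "Poly_Mapping.lookup D j = Poly_Mapping.lookup (char_divisor r v m) j"
  proof (cases "j \<in> {1..r}")
    case True
    then have "real_of_int (Poly_Mapping.lookup D j) = of_int (Poly_Mapping.lookup (char_divisor r v m) j)"
      by (simp only: assms(3) of_int_lookup_char_divisor[OF assms(1)])
    then show ?thesis
      by (simp only: of_int_eq_iff)
  next
    case False
    then show ?thesis
      using assms(2) by (auto simp: lookup_char_divisor in_keys_iff)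
  qed
qed

lemma keys_char_divisor: "Poly_Mapping.keys (char_divisor r v m) \<subseteq> {1..r}"
  by (auto simp: in_keys_iff lookup_char_divisor split: if_splits)

lemma char_divisor_add:
  assumes "m \<in> dual_lattice N" and "m' \<in> dual_lattice N"
  shows "char_divisor r v (m + m') = char_divisor r v m + char_divisor r v m'"
  using assms keys_add[of "char_divisor r v m" "char_divisor r v m'"] keys_char_divisor
  by (intro char_divisor_eqI[symmetric] dual_lattice_add)
    (auto simp: lookup_add of_int_lookup_char_divisor inner_add_left)

lemma char_divisor_uminus:
  assumes "m \<in> dual_lattice N"
  shows "char_divisor r v (- m) = - char_divisor r v m"
  using assms keys_char_divisor
  by (intro char_divisor_eqI[symmetric] dual_lattice_uminus)
    (auto simp: of_int_lookup_char_divisor)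

lemma char_divisor_zero: "char_divisor r v 0 = 0"
  by (rule poly_mapping_eqI) (simp add: lookup_char_divisor)

text \<open>Expand \<open>- m\<close> as a nonnegative combination of the \<open>v j\<close> and
  pair it with \<open>m\<close>: the result is nonnegative, yet it is minus the squared norm of
  \<open>m\<close>.\<close>

lemma eq_0_if_nonneg_on_rays:
  assumes "\<And>j. j \<in> {1..r} \<Longrightarrow> 0 \<le> m \<bullet> v j"
  shows "m = 0"
proof -
  obtain c where c: "\<forall>j. 0 \<le> c j" "- m = (\<Sum>j\<in>{1..r}. c j *\<^sub>R v j)"
    using nonneg_combination_of_rays[of "- m"] by blast
  have "0 \<le> (\<Sum>j\<in>{1..r}. c j * (m \<bullet> v j))"
    using c(1) assms by (intro sum_nonneg mult_nonneg_nonneg) auto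
  also have "\<dots> = m \<bullet> (- m)"
    unfolding c(2) by (simp add: inner_sum_right)
  finally have "m \<bullet> m \<le> 0"
    by simp
  then show ?thesis
    by (metis inner_gt_zero_iff not_le)
qed

text \<open>A character without poles on a complete variety is trivial; this yields
  \<open>E_Int_H\<close> below.\<close>

lemma char_divisor_eq_0D:
  assumes "m \<in> dual_lattice N" and "char_divisor r v m \<in> effective"
  shows "m = 0"
proof (rule eq_0_if_nonneg_on_rays)
  fix j assume "j \<in> {1..r}"
  then have "m \<bullet> v j = of_int (Poly_Mapping.lookup (char_divisor r v m) j)"
    using assms(1) of_int_lookup_char_divisor by simp
  then show "0 \<le> m \<bullet> v j"
    using assms(2) by (simp add: effective_def)
qed

section \<open>Lattice points of the polytope of a divisor\<close>

text \<open>Every vector is a nonnegative combination of the \<open>v j\<close>, so pairing with it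
  is bounded below on the polytope. For \<open>b\<close> and \<open>- b\<close> with
  \<open>b\<close> in a lattice basis, this encloses the integral coordinates in a finite
  box.\<close>

lemma finite_polytope_Int_dual: "finite (polytope_of r v D \<inter> dual_lattice N)"
proof -
  obtain B where B: "finite B" "span B = UNIV" "N = {\<Sum>b\<in>B. of_int (c b) *\<^sub>R b | c. True}"
    using lat unfolding is_lattice_def by blast
  have B_N: "b \<in> N" if "b \<in> B" for b
  proof -
    have "b = (\<Sum>b'\<in>B. of_int (if b' = b then 1 else 0) *\<^sub>R b')"
    proof -
      have "(\<Sum>b'\<in>B. of_int (if b' = b then 1 else 0) *\<^sub>R b') = (\<Sum>b'\<in>B. if b' = b then b' else 0)"
        by (rule sum.cong) auto
      then show ?thesis
        using that B(1) by simp
    qed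
    then show ?thesis
      unfolding B(3) by (auto intro!: exI[of _ "\<lambda>b'. if b' = b then 1 else 0"])
  qed
  have lower: "\<exists>l. \<forall>m\<in>polytope_of r v D. l \<le> m \<bullet> u" for u
  proof -
    obtain c where c: "\<forall>j. 0 \<le> c j" "u = (\<Sum>j\<in>{1..r}. c j *\<^sub>R v j)"
      using nonneg_combination_of_rays[of u] by blast
    have "(\<Sum>j\<in>{1..r}. c j * - of_int (Poly_Mapping.lookup D j)) \<le> m \<bullet> u" if "m \<in> polytope_of r v D" for m
      unfolding c(2) inner_sum_right inner_scaleR_right
      using that c(1) by (intro sum_mono mult_left_mono) (auto simp: polytope_of_def)
    then show ?thesis
      by blast
  qed
  then obtain l where l: "\<And>u m. m \<in> polytope_of r v D \<Longrightarrow> l u \<le> m \<bullet> u"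
    by metis
  \<comment> \<open>The coordinates of \<open>m\<close> are its pairings with the lattice basis;
    they determine \<open>m\<close> because the basis spans.\<close>
  let ?f = "\<lambda>m. \<lambda>b\<in>B. m \<bullet> b"
  have "?f ` (polytope_of r v D \<inter> dual_lattice N) \<subseteq> (\<Pi>\<^sub>E b\<in>B. {k \<in> \<int>. l b \<le> k \<and> k \<le> - l (- b)})"
  proof (intro image_subsetI, simp only: PiE_iff restrict_extensional simp_thms restrict_apply, intro conjI ballI restrict_extensional)
    fix m b assume m: "m \<in> polytope_of r v D \<inter> dual_lattice N" and b: "b \<in> B"
    have "m \<bullet> b \<in> \<int>"
      using m B_N[OF b] by (simp add: dual_lattice_def)
    moreover have "l b \<le> m \<bullet> b" "l (- b) \<le> m \<bullet> (- b)"
      using m by (blast intro: l)+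
    ultimately show "(if b \<in> B then m \<bullet> b else undefined) \<in> {k \<in> \<int>. l b \<le> k \<and> k \<le> - l (- b)}"
      using b by simp
  qed
  moreover have "finite (\<Pi>\<^sub>E b\<in>B. {k \<in> \<int>. l b \<le> k \<and> k \<le> - l (- b)})"
    using B(1) by (intro finite_PiE finite_int_segment)
  ultimately have "finite (?f ` (polytope_of r v D \<inter> dual_lattice N))"
    by (rule finite_subset)
  moreover have "inj_on ?f (polytope_of r v D \<inter> dual_lattice N)"
  proof (rule inj_onI)
    fix m m' assume eq: "?f m = ?f m'"
    have "(m - m') \<bullet> b = 0" if "b \<in> B" for b
      using fun_cong[OF eq, of b] that by (simp add: inner_diff_left)
    then have "B \<subseteq> {u. (m - m') \<bullet> u = 0}"
      by blast
    moreover have "subspace {u. (m - m') \<bullet> u = 0}"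
      by (simp add: subspace_def inner_add_right)
    ultimately have "span B \<subseteq> {u. (m - m') \<bullet> u = 0}"
      by (rule span_minimal)
    then have "(m - m') \<bullet> (m - m') = 0"
      using B(2) by blast
    then show "m = m'"
      by simp
  qed
  ultimately show ?thesis
    by (rule finite_imageD)
qed

text \<open>The inequalities of \<open>polytope_of\<close> say exactly that adding the divisor of
  the character \<open>m\<close> makes \<open>D\<close> effective. Lattice points thus count the
  monomials in the degree of \<open>D\<close>.\<close>

lemma bij_betw_polytope:
  assumes "Poly_Mapping.keys D \<subseteq> {1..r}"
  shows "bij_betw (\<lambda>m. D + char_divisor r v m) (polytope_of r v D \<inter> dual_lattice N)
    {x \<in> effective. x - D \<in> principal}"
proof -
  have eff: "D + char_divisor r v m \<in> effective \<longleftrightarrow> m \<in> polytope_of r v D" if m: "m \<in> dual_lattice N" for m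
  proof -
    have iff: "0 \<le> Poly_Mapping.lookup (D + char_divisor r v m) j \<longleftrightarrow> - of_int (Poly_Mapping.lookup D j) \<le> m \<bullet> v j"
      if j: "j \<in> {1..r}" for j
    proof -
      have "0 \<le> Poly_Mapping.lookup (D + char_divisor r v m) j
          \<longleftrightarrow> 0 \<le> real_of_int (Poly_Mapping.lookup D j) + of_int (Poly_Mapping.lookup (char_divisor r v m) j)"
        by (simp add: lookup_add flip: of_int_add)
      then show ?thesis
        unfolding of_int_lookup_char_divisor[OF m j] by linarith
    qed
    have keys: "Poly_Mapping.keys (D + char_divisor r v m) \<subseteq> {1..r}"
      using keys_add[of D "char_divisor r v m"] keys_char_divisor assms by blast
    then have "0 \<le> Poly_Mapping.lookup (D + char_divisor r v m) j" if "j \<notin> {1..r}" for j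
      using that in_keys_iff[of j "D + char_divisor r v m"] by fastforce
    then show ?thesis
      unfolding effective_def polytope_of_def using iff keys by blast
  qed
  show ?thesis
    unfolding bij_betw_def
  proof (intro conjI)
    show "inj_on (\<lambda>m. D + char_divisor r v m) (polytope_of r v D \<inter> dual_lattice N)"
    proof (rule inj_onI)
      fix m m' assume m: "m \<in> polytope_of r v D \<inter> dual_lattice N" "m' \<in> polytope_of r v D \<inter> dual_lattice N"
        and eq: "D + char_divisor r v m = D + char_divisor r v m'"
      have "0 \<le> (m - m') \<bullet> v j" if j: "j \<in> {1..r}" for j
        using m eq of_int_lookup_char_divisor[OF _ j, of m] of_int_lookup_char_divisor[OF _ j, of m']
        by (simp add: inner_diff_left)
      then have "m - m' = 0"
        by (rule eq_0_if_nonneg_on_rays)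
      then show "m = m'"
        by simp
    qed
    show "(\<lambda>m. D + char_divisor r v m) ` (polytope_of r v D \<inter> dual_lattice N) = {x \<in> effective. x - D \<in> principal}"
    proof
      show "(\<lambda>m. D + char_divisor r v m) ` (polytope_of r v D \<inter> dual_lattice N) \<subseteq> {x \<in> effective. x - D \<in> principal}"
        using eff by (auto simp: principal_def)
      show "{x \<in> effective. x - D \<in> principal} \<subseteq> (\<lambda>m. D + char_divisor r v m) ` (polytope_of r v D \<inter> dual_lattice N)"
      proof
        fix x assume x: "x \<in> {x \<in> effective. x - D \<in> principal}"
        then obtain m where m: "m \<in> dual_lattice N" "x - D = char_divisor r v m"
          by (auto simp: principal_def)
        then have "x = D + char_divisor r v m"
          by (simp add: algebra_simps)
        then show "x \<in> (\<lambda>m. D + char_divisor r v m) ` (polytope_of r v D \<inter> dual_lattice N)"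
          using x m(1) eff by blast
      qed
    qed
  qed
qed

end

section \<open>The homogeneous coordinate ring\<close>

lemma ring_on_simps [simp]:
  "carrier (ring_on A) = A" "x \<otimes>\<^bsub>ring_on A\<^esub> y = x * y" "\<one>\<^bsub>ring_on A\<^esub> = 1"
  "\<zero>\<^bsub>ring_on A\<^esub> = 0" "x \<oplus>\<^bsub>ring_on A\<^esub> y = x + y"
  by (simp_all add: ring_on_def)

lemma cring_ring_on:
  fixes A :: "'b::comm_ring_1 set"
  assumes "1 \<in> A" and "\<And>x y. x \<in> A \<Longrightarrow> y \<in> A \<Longrightarrow> x + y \<in> A"
    and "\<And>x. x \<in> A \<Longrightarrow> - x \<in> A" and "\<And>x y. x \<in> A \<Longrightarrow> y \<in> A \<Longrightarrow> x * y \<in> A"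
  shows "cring (ring_on A)"
proof (rule cringI)
  have "1 + - 1 \<in> A"
    using assms by blast
  then have "0 \<in> A"
    by simp
  then show "abelian_group (ring_on A)"
  proof (intro abelian_groupI)
    fix x assume "x \<in> carrier (ring_on A)"
    then show "\<exists>y\<in>carrier (ring_on A). y \<oplus>\<^bsub>ring_on A\<^esub> x = \<zero>\<^bsub>ring_on A\<^esub>"
      using assms(3) by (intro bexI[of _ "- x"]) auto
  qed (auto simp: assms add_ac)
  show "comm_monoid (ring_on A)"
    by (rule comm_monoidI) (auto simp: assms mult_ac)
qed (auto simp: distrib_right)

context complete_simplicial_fan
begin

text \<open>With principal divisors as the exponents of degree zero, degrees are divisor classes.
  Completeness of the fan enters in the last two conditions: no nonzero effective divisor is
  principal, and a class has only finitely many effective members.\<close>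

sublocale cox: graded_monoid_algebra effective principal
proof
  have principal_diff: "x - y \<in> principal" if x: "x \<in> principal" and y: "y \<in> principal" for x y
  proof -
    obtain m m' where "m \<in> dual_lattice N" "x = char_divisor r v m" "m' \<in> dual_lattice N" "y = char_divisor r v m'"
      using x y by (auto simp: principal_def)
    then have "x - y = char_divisor r v (m + - m')"
      by (simp only: char_divisor_add char_divisor_uminus dual_lattice_uminus diff_conv_add_uminus)
    then show ?thesis
      using \<open>m \<in> dual_lattice N\<close> \<open>m' \<in> dual_lattice N\<close> unfolding principal_def
      by (simp only: imageI dual_lattice_add dual_lattice_uminus)
  qed
  show zero: "0 \<in> principal"
    using char_divisor_zero zero_in_dual_lattice unfolding principal_def by (metis image_eqI)
  show "- x \<in> principal" if "x \<in> principal" for x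
    using principal_diff[OF zero that] by simp
  show "x + y \<in> principal" if "x \<in> principal" "y \<in> principal" for x y
    using principal_diff[OF that(1) principal_diff[OF zero that(2)]] by simp
  show "0 \<in> effective"
    by (simp add: effective_def)
  show "x + y \<in> effective" if "x \<in> effective" "y \<in> effective" for x y
    using that keys_add[of x y] by (auto simp: effective_def lookup_add)
  show "x = 0" if "x \<in> effective" "- x \<in> effective" for x
  proof (rule poly_mapping_eqI)
    fix j
    have "0 \<le> Poly_Mapping.lookup x j" "0 \<le> Poly_Mapping.lookup (- x) j"
      using that by (auto simp only: effective_def)
    then show "Poly_Mapping.lookup x j = Poly_Mapping.lookup 0 j"
      by simp
  qed
  show "x = 0" if "x \<in> effective" "x \<in> principal" for x
    using that char_divisor_eq_0D char_divisor_zero by (auto simp: principal_def)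
  show "finite {x \<in> effective. x - a \<in> principal}" for a
  \<comment> \<open>If the class of \<open>a\<close> has an effective member, then \<open>a\<close>
    differs from it by a principal divisor and is supported on \<open>{1..r}\<close>, so the
    polytope bijection applies; otherwise the set is empty.\<close>
  proof (cases "\<exists>x. x \<in> effective \<and> x - a \<in> principal")
    case True
    then obtain x m where x: "x \<in> effective" "x - a = char_divisor r v m"
      by (auto simp: principal_def)
    then have "a = x + - char_divisor r v m"
      by (simp add: algebra_simps)
    then have "Poly_Mapping.keys a \<subseteq> {1..r}"
      using x(1) keys_char_divisor keys_add[of x "- char_divisor r v m"] by (auto simp: effective_def)
    then show ?thesis
      using bij_betw_finite[OF bij_betw_polytope] finite_polytope_Int_dual by blast
  next
    case False
    then have "{x \<in> effective. x - a \<in> principal} = {}"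
      by blast
    then show ?thesis
      by (simp only: finite.emptyI)
  qed
qed

section \<open>Translation between \<open>cox_ring\<close> and the graded monoid algebra\<close>

lemma carrier_cox_ring: "carrier (cox_ring r) = cox.alg"
  unfolding cox_ring_def ring_on_simps cox.alg_def by (auto simp: effective_def)

lemma cox_ring_simps [simp]:
  "x \<otimes>\<^bsub>cox_ring r\<^esub> y = x * y" "\<one>\<^bsub>cox_ring r\<^esub> = 1" "\<zero>\<^bsub>cox_ring r\<^esub> = 0" "x \<oplus>\<^bsub>cox_ring r\<^esub> y = x + y"
  by (simp_all add: cox_ring_def)

lemma cring_cox_ring: "cring (cox_ring r :: (divisor \<Rightarrow>\<^sub>0 'k::field) ring)"
proof -
  have "cox_ring r = ring_on (cox.alg :: (divisor \<Rightarrow>\<^sub>0 'k) set)"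
    unfolding cox_ring_def cox.alg_def by (rule arg_cong[where f = ring_on]) (auto simp: effective_def)
  then show ?thesis
    by (simp add: cring_ring_on cox.alg_one cox.alg_add cox.alg_uminus cox.alg_mult)
qed

lemma ideal_cox_ring:
  assumes "cox.graded_ideal J"
  shows "ideal J (cox_ring r)"
proof (rule idealI)
  show "ring (cox_ring r :: (divisor \<Rightarrow>\<^sub>0 'b) ring)"
    using cring_cox_ring by (rule cring.axioms(1))
  then interpret ring "cox_ring r :: (divisor \<Rightarrow>\<^sub>0 'b) ring" .
  show "subgroup J (add_monoid (cox_ring r))"
  proof (rule add.subgroupI)
    show "J \<subseteq> carrier (cox_ring r)" "J \<noteq> {}"
      using assms by (auto simp: carrier_cox_ring cox.graded_ideal_def)
    show "\<ominus>\<^bsub>cox_ring r\<^esub> f \<in> J" if "f \<in> J" for f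
    proof -
      have "\<ominus>\<^bsub>cox_ring r\<^esub> f = - f"
        using assms that by (intro minus_equality)
          (auto simp: carrier_cox_ring cox.graded_ideal_def cox.alg_uminus)
      then show ?thesis
        using cox.graded_ideal_uminus[OF assms that] by simp
    qed
    show "f \<oplus>\<^bsub>cox_ring r\<^esub> g \<in> J" if "f \<in> J" "g \<in> J" for f g
      using assms that by (simp add: cox.graded_ideal_def)
  qed
qed (use assms in \<open>auto simp: carrier_cox_ring cox.graded_ideal_def mult.commute\<close>)

text \<open>This replaces the abstract generated ideal by explicit combinations, so that the results
  on \<open>gen\<close> apply.\<close>

lemma Idl_eq_gen:
  fixes F :: "nat \<Rightarrow> divisor \<Rightarrow>\<^sub>0 'k::field"
  assumes F: "\<And>i. i \<in> {1..k} \<Longrightarrow> F i \<in> cox.hom (b i)"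
  shows "Idl\<^bsub>cox_ring r\<^esub> (F ` {1..k}) = cox.gen cox.alg F k"
proof
  interpret cring "cox_ring r :: (divisor \<Rightarrow>\<^sub>0 'k) ring"
    by (rule cring_cox_ring)
  have sub: "F ` {1..k} \<subseteq> carrier (cox_ring r)"
    using F cox.hom_subset_alg unfolding carrier_cox_ring by blast
  have "F i \<in> cox.gen cox.alg F k" if "i \<in> {1..k}" for i
    using that by (rule cox.generator_in_gen)
  then show "Idl\<^bsub>cox_ring r\<^esub> (F ` {1..k}) \<subseteq> cox.gen cox.alg F k"
    using F by (intro genideal_minimal ideal_cox_ring cox.graded_ideal_gen[OF cox.graded_ideal_alg]) auto
  interpret I: ideal "Idl\<^bsub>cox_ring r\<^esub> (F ` {1..k})" "cox_ring r"
    by (rule genideal_ideal[OF sub])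
  show "cox.gen cox.alg F k \<subseteq> Idl\<^bsub>cox_ring r\<^esub> (F ` {1..k})"
  proof
    fix f assume "f \<in> cox.gen cox.alg F k"
    then obtain h where h: "f = (\<Sum>i\<in>{1..k}. h i * F i)" "\<forall>i\<in>{1..k}. h i \<in> cox.alg"
      by (auto simp: cox.gen_def)
    have "(\<Sum>i\<in>I. h i * F i) \<in> Idl\<^bsub>cox_ring r\<^esub> (F ` {1..k})" if "I \<subseteq> {1..k}" for I
      using that
    proof (induction I rule: infinite_finite_induct)
      case (insert i I)
      have "F i \<in> Idl\<^bsub>cox_ring r\<^esub> (F ` {1..k})"
        using genideal_self[OF sub] insert.prems by blast
      then have "h i \<otimes>\<^bsub>cox_ring r\<^esub> F i \<in> Idl\<^bsub>cox_ring r\<^esub> (F ` {1..k})"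
        using h(2) insert.prems by (intro I.I_l_closed) (auto simp: carrier_cox_ring)
      then show ?case
        using I.a_closed[of "h i * F i" "\<Sum>i\<in>I. h i * F i"] insert by simp
    qed (use I.zero_closed in auto)
    then show "f \<in> Idl\<^bsub>cox_ring r\<^esub> (F ` {1..k})"
      using h(1) by blast
  qed
qed

lemma regular_sequenceD:
  fixes F :: "nat \<Rightarrow> divisor \<Rightarrow>\<^sub>0 'k::field"
  assumes F: "\<And>i. i \<in> {1..k} \<Longrightarrow> F i \<in> cox.hom (b i)" and "regular_sequence (cox_ring r) k F"
  shows "cox.regular_seq F k" and "1 \<notin> cox.gen cox.alg F k"
proof -
  show "cox.regular_seq F k"
    unfolding cox.regular_seq_def
  proof (intro allI impI ballI)
    fix i g assume i: "i < k" and g: "g \<in> cox.alg" "g * F (Suc i) \<in> cox.gen cox.alg F i"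
    have "Idl\<^bsub>cox_ring r\<^esub> (F ` {1..i}) = cox.gen cox.alg F i"
      using i by (intro Idl_eq_gen[where b = b] F) simp
    \<comment> \<open>The predecessors of \<open>F (Suc i)\<close> have the indices
      \<open>{1..<Suc i}\<close>, that is \<open>{1..i}\<close>.\<close>
    then have Idl: "Idl\<^bsub>cox_ring r\<^esub> (F ` {1..<Suc i}) = cox.gen cox.alg F i"
      by (simp only: atLeastLessThanSuc_atLeastAtMost)
    have "F (Suc i) \<otimes>\<^bsub>cox_ring r\<^esub> g \<in> Idl\<^bsub>cox_ring r\<^esub> (F ` {1..<Suc i})
        \<longrightarrow> g \<in> Idl\<^bsub>cox_ring r\<^esub> (F ` {1..<Suc i})"
      using assms(2) i g(1) unfolding regular_sequence_def carrier_cox_ring by simp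
    then show "g \<in> cox.gen cox.alg F i"
      using g(2) unfolding Idl cox_ring_simps by (simp add: mult.commute)
  qed
  \<comment> \<open>An ideal containing 1 is the whole ring, which a regular sequence
    excludes.\<close>
  interpret ideal "cox.gen cox.alg F k" "cox_ring r"
    using F by (intro ideal_cox_ring cox.graded_ideal_gen[OF cox.graded_ideal_alg])
  show "1 \<notin> cox.gen cox.alg F k"
    using one_imp_carrier assms(2) Idl_eq_gen[OF F] by (auto simp: regular_sequence_def)
qed

section \<open>The Hilbert function as a codimension\<close>

lemma subfield_constants:
  "subfield (range (Poly_Mapping.single 0)) (cox_ring r :: (divisor \<Rightarrow>\<^sub>0 'k::field) ring)"
proof -
  interpret cring "cox_ring r :: (divisor \<Rightarrow>\<^sub>0 'k) ring"
    by (rule cring_cox_ring)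
  let ?K = "range (Poly_Mapping.single 0) :: (divisor \<Rightarrow>\<^sub>0 'k) set"
  have "cring (ring_on ?K)"
  proof (rule cring_ring_on)
    show "1 \<in> ?K"
      by (metis single_one rangeI)
    show "x + y \<in> ?K" if "x \<in> ?K" "y \<in> ?K" for x y
      using that by (auto simp flip: single_add)
    show "- x \<in> ?K" if "x \<in> ?K" for x
      using that by (auto simp flip: single_uminus)
    show "x * y \<in> ?K" if "x \<in> ?K" "y \<in> ?K" for x y
      using that by (auto simp: mult_single)
  qed
  then interpret K: cring "ring_on ?K" .
  have "field (ring_on ?K)"
  proof (rule K.cring_fieldI2)
    fix x assume "x \<in> carrier (ring_on ?K)" "x \<noteq> \<zero>\<^bsub>ring_on ?K\<^esub>"
    moreover from this obtain c where c: "x = Poly_Mapping.single 0 c"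
      by auto
    ultimately have "x * Poly_Mapping.single 0 (inverse c) = 1"
      by (cases "c = 0") (simp_all add: mult_single single_one)
    then show "\<exists>y\<in>carrier (ring_on ?K). x \<otimes>\<^bsub>ring_on ?K\<^esub> y = \<one>\<^bsub>ring_on ?K\<^esub>"
      by auto
  qed simp
  moreover have "(cox_ring r)\<lparr>carrier := ?K\<rparr> = ring_on ?K"
    by (simp add: cox_ring_def ring_on_def)
  moreover have "?K \<subseteq> carrier (cox_ring r)"
    by (auto simp: carrier_cox_ring cox.alg_const)
  ultimately show ?thesis
    by (intro subfield_iff(1)) simp_all
qed

text \<open>A basis \<open>Z\<close> of a complement of J in degree \<open>a\<close> maps to a basis
  of the graded piece of the quotient. Its members are adjoined one by one, since the dimension in a
  ring is built from line extensions.\<close>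

lemma hilbert_function_eq_codim:
  fixes J :: "(divisor \<Rightarrow>\<^sub>0 'k::field) set"
  assumes J: "cox.graded_ideal J" and proper: "1 \<notin> J"
    and \<alpha>: "(graded_part r \<alpha> :: (divisor \<Rightarrow>\<^sub>0 'k) set) = cox.hom a"
  shows "pm.dim (cox.hom a :: (divisor \<Rightarrow>\<^sub>0 'k) set) = pm.dim (J \<inter> cox.hom a) + hilbert_function r J \<alpha>"
proof -
  let ?R = "cox_ring r :: (divisor \<Rightarrow>\<^sub>0 'k) ring"
  interpret R: cring ?R
    by (rule cring_cox_ring)
  interpret I: ideal J ?R
    by (rule ideal_cox_ring[OF J])
  define \<pi> where "\<pi> f = J +>\<^bsub>?R\<^esub> f" for f
  interpret Q: ring "?R Quot J"
    by (rule I.quotient_is_ring)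
  interpret hom: ring_hom_ring ?R "?R Quot J" \<pi>
    using I.rcos_ring_hom_ring by (simp add: \<pi>_def[abs_def])
  have \<pi>_image: "\<pi> f = (\<lambda>h. h + f) ` J" for f
    by (auto simp: \<pi>_def a_r_coset_def')
  have zero_J: "0 \<in> J"
    using J by (auto simp: cox.graded_ideal_def)
  have \<pi>_eqI: "\<pi> f = \<pi> g" if fg: "f - g \<in> J" for f g
  proof -
    have "\<pi> f \<subseteq> \<pi> g" if d: "f - g \<in> J" for f g
    proof
      fix x assume "x \<in> \<pi> f"
      then obtain h where h: "h \<in> J" "x = h + f"
        by (auto simp: \<pi>_image)
      have "h + (f - g) \<in> J"
        using J h(1) d by (simp add: cox.graded_ideal_def)
      moreover have "x = h + (f - g) + g"
        using h(2) by simp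
      ultimately show "x \<in> \<pi> g"
        unfolding \<pi>_image by blast
    qed
    moreover have "g - f \<in> J"
      using cox.graded_ideal_uminus[OF J fg] by simp
    ultimately show ?thesis
      using fg by blast
  qed
  have \<pi>_eqD: "f - g \<in> J" if "\<pi> f = \<pi> g" for f g
  proof -
    have "0 + f \<in> \<pi> g"
      using that zero_J unfolding \<pi>_image by blast
    then obtain h where "h \<in> J" "0 + f = h + g"
      unfolding \<pi>_image by blast
    then show ?thesis
      by simp
  qed
  define K where "K = \<pi> ` range (Poly_Mapping.single 0)"
  have "\<one>\<^bsub>?R Quot J\<^esub> \<noteq> \<zero>\<^bsub>?R Quot J\<^esub>"
  proof
    assume "\<one>\<^bsub>?R Quot J\<^esub> = \<zero>\<^bsub>?R Quot J\<^esub>"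
    then have "\<pi> 1 = \<pi> 0"
      using hom.hom_one hom.hom_zero by simp
    then show False
      using \<pi>_eqD[of 1 0] proper by simp
  qed
  \<comment> \<open>Properness of \<open>J\<close> makes the quotient nontrivial, so the image of
    the constants is again a field.\<close>
  then have K: "subfield K (?R Quot J)"
    unfolding K_def by (rule hom.img_is_subfield(2)[OF subfield_constants])
  have sub: "pm.subspace (J \<inter> cox.hom a)"
    by (intro pm.subspace_inter cox.subspace_graded_ideal[OF J] cox.subspace_hom)
  obtain Z where Z: "finite Z" "Z \<subseteq> cox.hom a"
      "pm.dim (cox.hom a :: (divisor \<Rightarrow>\<^sub>0 'k) set) = pm.dim (J \<inter> cox.hom a) + card Z"
    and Z_indep: "\<And>c. (\<Sum>z\<in>Z. Poly_Mapping.single 0 (c z) * z) \<in> J \<inter> cox.hom a \<Longrightarrow> \<forall>z\<in>Z. c z = 0"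
    and Z_span: "\<And>x. x \<in> cox.hom a \<Longrightarrow> \<exists>c. x - (\<Sum>z\<in>Z. Poly_Mapping.single 0 (c z) * z) \<in> J \<inter> cox.hom a"
    by (rule pm.exists_complement_basis[OF sub Int_lower2 cox.hom_subset_span]) (auto simp: cox.finite_degree)
  \<comment> \<open>As \<open>c\<close> varies, the images of \<open>S A c\<close> run through the
    span of the image of \<open>A\<close>.\<close>
  define S where "S A c = (\<Sum>z\<in>A. Poly_Mapping.single 0 (c z) * z)" for A and c :: "(divisor \<Rightarrow>\<^sub>0 'k) \<Rightarrow> 'k"
  have S_hom: "S A c \<in> cox.hom a" if "A \<subseteq> Z" for A c
    unfolding S_def using that Z(2)
    by (intro pm.subspace_sum[OF cox.subspace_hom] pm.subspace_scale[OF cox.subspace_hom]) auto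
  then have S_alg: "S A c \<in> carrier ?R" if "A \<subseteq> Z" for A c
    using that cox.hom_subset_alg unfolding carrier_cox_ring by blast
  have Z_alg: "z \<in> carrier ?R" if "z \<in> Z" for z
    using that Z(2) cox.hom_subset_alg unfolding carrier_cox_ring by blast
  have "Q.dimension (card A) K (range (\<lambda>c. \<pi> (S A c)))" if "A \<subseteq> Z" for A
    using finite_subset[OF that Z(1)] that
  proof (induction A rule: finite_induct)
    case empty
    have "range (\<lambda>c. \<pi> (S {} c)) = {\<zero>\<^bsub>?R Quot J\<^esub>}"
      using hom.hom_zero by (simp add: S_def)
    then show ?case
      by (simp add: Q.zero_dim)
  next
    case (insert z A)
    have z: "z \<in> Z" and A: "A \<subseteq> Z"
      using insert.prems by auto
    have S_insert: "S (insert z A) c = Poly_Mapping.single 0 (c z) * z + S A c" for c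
      using insert.hyps by (simp add: S_def)
    have \<pi>_insert: "\<pi> (Poly_Mapping.single 0 k * z + S A c)
        = \<pi> (Poly_Mapping.single 0 k) \<otimes>\<^bsub>?R Quot J\<^esub> \<pi> z \<oplus>\<^bsub>?R Quot J\<^esub> \<pi> (S A c)" for k c
    proof -
      have k: "Poly_Mapping.single 0 k \<in> carrier ?R"
        by (simp add: carrier_cox_ring cox.alg_const)
      have kz: "Poly_Mapping.single 0 k * z \<in> carrier ?R"
        using R.m_closed[OF k Z_alg[OF z]] by simp
      show ?thesis
        using hom.hom_add[OF kz S_alg[OF A]] hom.hom_mult[OF k Z_alg[OF z]] by simp
    qed
    have "range (\<lambda>c. \<pi> (S (insert z A) c)) = Q.line_extension K (\<pi> z) (range (\<lambda>c. \<pi> (S A c)))"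
    proof (intro equalityI subsetI)
      fix u assume "u \<in> range (\<lambda>c. \<pi> (S (insert z A) c))"
      then show "u \<in> Q.line_extension K (\<pi> z) (range (\<lambda>c. \<pi> (S A c)))"
        unfolding Q.line_extension_mem_iff K_def S_insert \<pi>_insert by blast
    next
      fix u assume "u \<in> Q.line_extension K (\<pi> z) (range (\<lambda>c. \<pi> (S A c)))"
      then obtain k c where u: "u = \<pi> (Poly_Mapping.single 0 k * z + S A c)"
        unfolding Q.line_extension_mem_iff K_def \<pi>_insert by blast
      \<comment> \<open>As \<open>z\<close> is not in \<open>A\<close>, its coefficient can be
        chosen freely.\<close>
      have "S A (c(z := k)) = S A c"
        unfolding S_def using insert.hyps by (intro sum.cong) auto
      then have "u = \<pi> (S (insert z A) (c(z := k)))"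
        unfolding u S_insert by simp
      then show "u \<in> range (\<lambda>c. \<pi> (S (insert z A) c))"
        by blast
    qed
    moreover have "\<pi> z \<notin> range (\<lambda>c. \<pi> (S A c))"
    proof
      assume "\<pi> z \<in> range (\<lambda>c. \<pi> (S A c))"
      then obtain c where c: "\<pi> z = \<pi> (S A c)"
        by blast
      have "z - S A c \<in> J \<inter> cox.hom a"
        using \<pi>_eqD[OF c] cox.mem_hom_diff[of z a "S A c"] S_hom[OF A] z Z(2) by blast
      \<comment> \<open>\<open>d\<close> holds the coefficients of \<open>z - S A c\<close>,
        extended by 0 to all of \<open>Z\<close>; the value 1 at \<open>z\<close> contradicts
        independence modulo \<open>J\<close>.\<close>
      moreover define d where "d x = (if x = z then 1 else if x \<in> A then - c x else 0)" for x
      have "z - S A c = S (insert z A) d"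
      proof -
        have "S A d = (\<Sum>x\<in>A. - (Poly_Mapping.single 0 (c x) * x))"
          unfolding S_def using insert.hyps by (intro sum.cong) (auto simp: d_def single_uminus)
        then show ?thesis
          unfolding S_insert by (simp add: S_def d_def sum_negf)
      qed
      moreover have "S (insert z A) d = S Z d"
        unfolding S_def using insert.prems Z(1) by (intro sum.mono_neutral_left) (auto simp: d_def)
      ultimately have "d z = 0"
        using Z_indep[of d] z unfolding S_def by simp
      then show False
        by (simp add: d_def)
    qed
    ultimately show ?case
      using Q.Suc_dim[OF hom.hom_closed[OF Z_alg[OF z]] _ insert.IH[OF A]] insert.hyps by simp
  qed
  then have "Q.dimension (card Z) K (range (\<lambda>c. \<pi> (S Z c)))"
    by blast
  moreover have "range (\<lambda>c. \<pi> (S Z c)) = \<pi> ` cox.hom a"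
  proof
    show "range (\<lambda>c. \<pi> (S Z c)) \<subseteq> \<pi> ` cox.hom a"
      using S_hom[OF subset_refl] by blast
    show "\<pi> ` cox.hom a \<subseteq> range (\<lambda>c. \<pi> (S Z c))"
    proof
      fix u assume "u \<in> \<pi> ` cox.hom a"
      then obtain x where x: "x \<in> cox.hom a" "u = \<pi> x"
        by blast
      then obtain c where "x - S Z c \<in> J"
        using Z_span unfolding S_def by blast
      then show "u \<in> range (\<lambda>c. \<pi> (S Z c))"
        using \<pi>_eqI x(2) by blast
    qed
  qed
  ultimately have "Q.dim K (\<pi> ` cox.hom a) = card Z"
    using Q.dimI[OF K] by (simp add: over_def)
  moreover have "hilbert_function r J \<alpha> = Q.dim K (\<pi> ` cox.hom a)"
    unfolding hilbert_function_def \<alpha> K_def \<pi>_def by (simp add: image_image)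
  ultimately show ?thesis
    using Z(3) by simp
qed

section \<open>Divisor classes and the class group\<close>

definition divisor_class :: "divisor \<Rightarrow> divisor set" where
  "divisor_class D = {D'. D' - D \<in> principal}"

lemma graded_part_divisor_class: "graded_part r (divisor_class D) = cox.hom D"
  by (auto simp: graded_part_def carrier_cox_ring cox.alg_def cox.hom_def divisor_class_def)

lemma subgroup_principal: "subgroup principal (free_Abelian_group {1..r})"
proof (rule group.subgroupI)
  show "principal \<subseteq> carrier (free_Abelian_group {1..r})"
    using keys_char_divisor by (auto simp: principal_def)
  then show "inv\<^bsub>free_Abelian_group {1..r}\<^esub> x \<in> principal" if "x \<in> principal" for x
    using that cox.uminus_H[OF that] by auto
qed (use cox.zero_H in \<open>auto intro: cox.add_H\<close>)

lemma comm_group_Cl: "comm_group (Cl N r v)"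
  unfolding Cl_def principal_def[symmetric]
  by (rule comm_group.abelian_FactGroup[OF abelian_free_Abelian_group subgroup_principal])

lemma carrier_Cl: "carrier (Cl N r v) = divisor_class ` {D. Poly_Mapping.keys D \<subseteq> {1..r}}"
proof -
  have "principal #>\<^bsub>free_Abelian_group {1..r}\<^esub> D = divisor_class D" for D
  proof -
    have "principal #>\<^bsub>free_Abelian_group {1..r}\<^esub> D = (\<lambda>h. h + D) ` principal"
      by (auto simp: r_coset_def)
    also have "\<dots> = divisor_class D"
    proof
      show "divisor_class D \<subseteq> (\<lambda>h. h + D) ` principal"
      proof
        fix x assume "x \<in> divisor_class D"
        then show "x \<in> (\<lambda>h. h + D) ` principal"
          by (intro image_eqI[of _ _ "x - D"]) (auto simp: divisor_class_def)
      qed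
    qed (auto simp: divisor_class_def)
    finally show ?thesis .
  qed
  then show ?thesis
    unfolding Cl_def principal_def[symmetric] FactGroup_def RCOSETS_def by auto
qed

lemma divisor_class_add:
  "divisor_class D \<otimes>\<^bsub>Cl N r v\<^esub> divisor_class D' = divisor_class (D + D')"
proof -
  have "divisor_class D \<otimes>\<^bsub>Cl N r v\<^esub> divisor_class D' = {x + y |x y. x \<in> divisor_class D \<and> y \<in> divisor_class D'}"
    by (auto simp: Cl_def set_mult_def)
  also have "\<dots> = divisor_class (D + D')"
  proof (intro equalityI subsetI)
    fix z assume "z \<in> {x + y |x y. x \<in> divisor_class D \<and> y \<in> divisor_class D'}"
    then obtain x y where z: "z = x + y" "x - D \<in> principal" "y - D' \<in> principal"
      by (auto simp: divisor_class_def)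
    have "z - (D + D') = (x - D) + (y - D')"
      by (simp add: z(1))
    also have "\<dots> \<in> principal"
      using z(2,3) by (rule cox.add_H)
    finally show "z \<in> divisor_class (D + D')"
      by (simp add: divisor_class_def)
  next
    fix z assume "z \<in> divisor_class (D + D')"
    then have "z - D' \<in> divisor_class D" "D' \<in> divisor_class D'" "z = (z - D') + D'"
      by (simp_all add: divisor_class_def cox.zero_H algebra_simps)
    then show "z \<in> {x + y |x y. x \<in> divisor_class D \<and> y \<in> divisor_class D'}"
      by blast
  qed
  finally show ?thesis .
qed

lemma one_Cl: "\<one>\<^bsub>Cl N r v\<^esub> = divisor_class 0"
  by (simp add: Cl_def divisor_class_def flip: principal_def)

lemma divisor_class_inv:
  assumes "Poly_Mapping.keys D \<subseteq> {1..r}"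
  shows "inv\<^bsub>Cl N r v\<^esub> divisor_class D = divisor_class (- D)"
proof -
  interpret comm_group "Cl N r v"
    by (rule comm_group_Cl)
  show ?thesis
    using assms by (intro inv_equality) (auto simp: divisor_class_add one_Cl carrier_Cl)
qed

lemma keys_sum_subset:
  assumes "\<And>i. i \<in> I \<Longrightarrow> Poly_Mapping.keys (D i) \<subseteq> A"
  shows "Poly_Mapping.keys (sum D I) \<subseteq> A"
  using assms
proof (induction I rule: infinite_finite_induct)
  case (insert i I)
  then show ?case
    using keys_add[of "D i" "sum D I"] by fastforce
qed auto

lemma divisor_class_sum:
  assumes "finite I" and "\<And>i. i \<in> I \<Longrightarrow> Poly_Mapping.keys (D i) \<subseteq> {1..r}"
    and "\<And>i. i \<in> I \<Longrightarrow> \<beta> i = divisor_class (D i)"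
  shows "finprod (Cl N r v) \<beta> I = divisor_class (sum D I)"
proof -
  interpret comm_group "Cl N r v"
    by (rule comm_group_Cl)
  show ?thesis
    using assms
  proof (induction I rule: finite_induct)
    case (insert i I)
    then have "finprod (Cl N r v) \<beta> (insert i I) = \<beta> i \<otimes>\<^bsub>Cl N r v\<^esub> finprod (Cl N r v) \<beta> I"
      by (intro finprod_insert) (auto simp: carrier_Cl)
    then show ?case
      using insert by (simp add: divisor_class_add)
  qed (simp add: one_Cl)
qed

text \<open>Both sides count the effective members of one class, so the representative does not
  matter; this allows an arbitrary \<open>rep\<close> in the theorem.\<close>

lemma card_polytope_eq:
  assumes "Poly_Mapping.keys D \<subseteq> {1..r}" and "D' \<in> divisor_class D"
  shows "card (polytope_of r v D' \<inter> dual_lattice N) = card {x \<in> effective. x - D \<in> principal}"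
proof -
  have D': "D' - D \<in> principal"
    using assms(2) by (simp add: divisor_class_def)
  then obtain m where "D' - D = char_divisor r v m"
    by (auto simp: principal_def)
  then have "D' = D + char_divisor r v m"
    by (simp add: algebra_simps)
  then have "Poly_Mapping.keys D' \<subseteq> {1..r}"
    using keys_add[of D "char_divisor r v m"] keys_char_divisor assms(1) by blast
  then have "card (polytope_of r v D' \<inter> dual_lattice N) = card {x \<in> effective. x - D' \<in> principal}"
    using bij_betw_same_card[OF bij_betw_polytope] by blast
  also have "x - D' \<in> principal \<longleftrightarrow> x - D \<in> principal" for x
    using cox.diff_H_iff[of "x - D" "x - D'"] D' by (simp add: algebra_simps)
  then have "{x \<in> effective. x - D' \<in> principal} = {x \<in> effective. x - D \<in> principal}"
    by blast
  finally show ?thesis .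
qed

end

section \<open>The alternating sum for a complete intersection of dimension zero\<close>

lemma sum_Pow_by_card:
  fixes f :: "'b set \<Rightarrow> int"
  assumes "finite A"
  shows "(\<Sum>s=0..card A. (- 1) ^ s * (\<Sum>I | I \<subseteq> A \<and> card I = s. f I)) = (\<Sum>I\<in>Pow A. (- 1) ^ card I * f I)"
proof -
  have "(\<Sum>s=0..card A. (- 1) ^ s * (\<Sum>I | I \<subseteq> A \<and> card I = s. f I))
      = (\<Sum>s=0..card A. \<Sum>I | I \<in> Pow A \<and> card I = s. (- 1) ^ card I * f I)"
    by (auto simp: sum_distrib_left intro!: sum.cong)
  also have "\<dots> = (\<Sum>I\<in>Pow A. (- 1) ^ card I * f I)"
    using assms by (intro sum.group) (auto simp: card_mono)
  finally show ?thesis .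
qed

theorem proposition3p13:
  fixes N :: "'a::real_inner set" and n r :: nat and \<Sigma> :: "'a set set" and v :: "nat \<Rightarrow> 'a"
    and Y :: "'a set \<Rightarrow> ('a \<Rightarrow>\<^sub>0 'k::alg_closed_field) set"
    and J :: "(divisor \<Rightarrow>\<^sub>0 'k) set"
    and G :: "nat \<Rightarrow> (divisor \<Rightarrow>\<^sub>0 'k)"
    and \<alpha>s :: "nat \<Rightarrow> divisor set" and \<alpha> :: "divisor set"
    and rep :: "divisor set \<Rightarrow> divisor"
  assumes "is_lattice N n" and "is_fan N \<Sigma>" and "complete_fan \<Sigma>" and "simplicial_fan \<Sigma>"
    and "primitive_ray_generators N \<Sigma> r v"
    and "torsion_free (Cl N r v)"
    and "closed_subscheme N \<Sigma> Y" and "has_dimension N \<Sigma> Y 0"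
    and "ideal_of_subscheme N \<Sigma> r v Y J"
    and "complete_intersection N n \<Sigma> r v Y J"
    and "\<And>i. i \<in> {1..n} \<Longrightarrow> \<alpha>s i \<in> carrier (Cl N r v)"
    and "\<And>i. i \<in> {1..n} \<Longrightarrow> G i \<in> graded_part r (\<alpha>s i)"
    and "J = Idl\<^bsub>cox_ring r\<^esub> (G ` {1..n})"
    and "\<alpha> \<in> carrier (Cl N r v)"
    and "\<And>\<beta>. \<beta> \<in> carrier (Cl N r v) \<Longrightarrow> rep \<beta> \<in> \<beta>"
  shows "int (hilbert_function r J \<alpha>) =
    (\<Sum>s=0..n. (- 1) ^ s *
      (\<Sum>I | I \<subseteq> {1..n} \<and> card I = s.
        int (card (polytope_of r v
          (rep (\<alpha> \<otimes>\<^bsub>Cl N r v\<^esub> inv\<^bsub>Cl N r v\<^esub> (finprod (Cl N r v) \<alpha>s I)))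
          \<inter> dual_lattice N))))"
proof -
  interpret complete_simplicial_fan N n \<Sigma> r v
    by unfold_locales (fact assms)+
  obtain d k F where dim: "has_dimension N \<Sigma> Y d" "k + d = n"
    and F_hom: "F ` {1..k} \<subseteq> homogeneous_elements r (carrier (Cl N r v))"
    and F_reg: "regular_sequence (cox_ring r) k F" and J_F: "J = Idl\<^bsub>cox_ring r\<^esub> (F ` {1..k})"
    using assms(10) unfolding complete_intersection_def by blast
  \<comment> \<open>\<open>complete_intersection\<close> brings its own dimension \<open>d\<close>.
    Its chain of primes is bounded by the dimension 0 of \<open>Y\<close>, so the regular sequence
    has length \<open>n\<close>.\<close>
  have "d \<le> 0"
    using dim(1) assms(8) unfolding has_dimension_def by blast
  then have k: "k = n"
    using dim(2) by simp
  \<comment> \<open>Degrees are replaced by representing divisors: \<open>b\<close> for the regular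
    sequence, \<open>c\<close> for the given generators, \<open>a\<close> for \<alpha>.\<close>
  have "\<exists>b. F i \<in> cox.hom b" if "i \<in> {1..n}" for i
  proof -
    have "F i \<in> homogeneous_elements r (carrier (Cl N r v))"
      using F_hom that k by blast
    then show ?thesis
      unfolding homogeneous_elements_def carrier_Cl by (auto simp: graded_part_divisor_class)
  qed
  then obtain b where F: "\<And>i. i \<in> {1..n} \<Longrightarrow> F i \<in> cox.hom (b i)"
    by metis
  have "\<exists>c. Poly_Mapping.keys c \<subseteq> {1..r} \<and> \<alpha>s i = divisor_class c" if "i \<in> {1..n}" for i
    using assms(11)[OF that] unfolding carrier_Cl by blast
  then obtain c where c: "\<And>i. i \<in> {1..n} \<Longrightarrow> Poly_Mapping.keys (c i) \<subseteq> {1..r}"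
      "\<And>i. i \<in> {1..n} \<Longrightarrow> \<alpha>s i = divisor_class (c i)"
    by metis
  obtain a where a: "Poly_Mapping.keys a \<subseteq> {1..r}" "\<alpha> = divisor_class a"
    using assms(14) unfolding carrier_Cl by blast
  have G: "G i \<in> cox.hom (c i)" if "i \<in> {1..n}" for i
    using assms(12)[OF that] c(2)[OF that] by (simp add: graded_part_divisor_class)
  \<comment> \<open>Both families generate the same ideal, which is what permits the comparison of
    their degrees.\<close>
  have J_gen: "J = cox.gen cox.alg F n" "J = cox.gen cox.alg G n"
    using J_F assms(13) Idl_eq_gen[of n F b, OF F] Idl_eq_gen[of n G c, OF G] k by simp_all
  note F_regular = regular_sequenceD[OF F F_reg[unfolded k]]
  \<comment> \<open>Operations in the class group become operations on representatives, and
    \<open>card_polytope_eq\<close> removes the dependence on \<open>rep\<close>.\<close>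
  have card_eq: "card (polytope_of r v (rep (\<alpha> \<otimes>\<^bsub>Cl N r v\<^esub> inv\<^bsub>Cl N r v\<^esub> (finprod (Cl N r v) \<alpha>s I))) \<inter> dual_lattice N)
      = card {x \<in> effective. x - (a - sum c I) \<in> principal}" if "I \<in> Pow {1..n}" for I
  proof -
    have I: "finite I" "\<And>i. i \<in> I \<Longrightarrow> i \<in> {1..n}"
      using that by (auto intro: finite_subset)
    have keys: "Poly_Mapping.keys (sum c I) \<subseteq> {1..r}"
      using c(1) I(2) by (intro keys_sum_subset) blast
    have "\<alpha> \<otimes>\<^bsub>Cl N r v\<^esub> inv\<^bsub>Cl N r v\<^esub> (finprod (Cl N r v) \<alpha>s I) = divisor_class (a - sum c I)"
      using c I divisor_class_add[of a "- sum c I"]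
      by (simp add: divisor_class_sum[of I c] divisor_class_inv[OF keys] a(2))
    moreover have keys_diff: "Poly_Mapping.keys (a - sum c I) \<subseteq> {1..r}"
      using keys_add[of a "- sum c I"] keys a(1) by auto
    moreover have "divisor_class (a - sum c I) \<in> carrier (Cl N r v)"
      using keys_diff unfolding carrier_Cl by blast
    ultimately show ?thesis
      using card_polytope_eq[OF keys_diff] assms(15) by simp
  qed
  have ideal: "cox.graded_ideal J"
    unfolding J_gen(1) using F by (rule cox.graded_ideal_gen[OF cox.graded_ideal_alg])
  have "int (hilbert_function r J \<alpha>)
      = int (pm.dim (cox.hom a :: (divisor \<Rightarrow>\<^sub>0 'k) set)) - int (pm.dim (J \<inter> cox.hom a))"
    using hilbert_function_eq_codim[OF ideal, of \<alpha> a] F_regular(2) J_gen(1)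
    by (simp add: a(2) graded_part_divisor_class)
  \<comment> \<open>Here the degrees of the regular sequence are exchanged for those of
    \<open>G\<close>.\<close>
  also have "\<dots> = (\<Sum>I\<in>Pow {1..n}. (- 1) ^ card I * int (card {x \<in> effective. x - (a - sum c I) \<in> principal}))"
    by (rule cox.codim_gen_complete_intersection[where a = a and G = G and c = c,
          OF F G F_regular J_gen(2)[unfolded J_gen(1)], folded J_gen(2)])
  also have "\<dots> = (\<Sum>I\<in>Pow {1..n}. (- 1) ^ card I * int (card (polytope_of r v
          (rep (\<alpha> \<otimes>\<^bsub>Cl N r v\<^esub> inv\<^bsub>Cl N r v\<^esub> (finprod (Cl N r v) \<alpha>s I))) \<inter> dual_lattice N)))"
    by (rule sum.cong) (simp_all only: card_eq)
  finally have *: "int (hilbert_function r J \<alpha>) = \<dots>" .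
  have "(\<Sum>s=0..n. (- 1) ^ s * (\<Sum>I | I \<subseteq> {1..n} \<and> card I = s. f I))
      = (\<Sum>I\<in>Pow {1..n}. (- 1) ^ card I * f I)" for f :: "nat set \<Rightarrow> int"
    using sum_Pow_by_card[of "{1..n}" f] by simp
  then show ?thesis
    by (simp only: *)
qed

end
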